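(* Let $\mathcal{A}$ be a Banach algebra such that $\mathrm{rad}(\mathcal{A})=\mathrm{rann}(\mathcal{A})$ and $\mathcal{A}/\mathrm{rad}(\mathcal{A})$ is commutative. If $\mathcal{A}$ has a right identity, then every generalized derivation of $\mathcal{A}$ is spectrally bounded.
   Context: $\mathrm{rad}(\mathcal{A})$ is the Jacobson radical and $\mathrm{rann}(\mathcal{A})=\{c\in\mathcal{A}: ac=0\ \forall a\in\mathcal{A}\}$. A derivation is a linear map $d:\mathcal{A}\to\mathcal{A}$ with $d(ab)=d(a)b+ad(b)$. A generalized derivation of $\mathcal{A}$ is a linear map $\delta:\mathcal{A}\to\mathcal{A}$ for which there exists a derivation $d$ of $\mathcal{A}$ with $\delta(ab)=a\delta(b)+d(a)b$ for all $a,b\in\mathcal{A}$. A linear map $T:\mathcal{A}\to\mathcal{A}$ is spectrally bounded if there is $M\ge 0$ with $r(T(a))\le M\,r(a)$ for all $a\in\mathcal{A}$, where $r$ denotes spectral radius. *)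

theory Defs
  imports "HOL-Analysis.Analysis"
begin

class complex_banach_algebra = real_normed_algebra + banach +
  fixes scaleC :: "complex \<Rightarrow> 'a \<Rightarrow> 'a"
  assumes scaleC_add_right: "scaleC c (x + y) = scaleC c x + scaleC c y"
    and scaleC_add_left: "scaleC (c + d) x = scaleC c x + scaleC d x"
    and scaleC_scaleC: "scaleC c (scaleC d x) = scaleC (c * d) x"
    and scaleC_one: "scaleC 1 x = x"
    and scaleC_of_real: "scaleC (complex_of_real r) x = scaleR r x"
    and norm_scaleC: "norm (scaleC c x) = cmod c * norm x"
    and mult_scaleC_left: "scaleC c x * y = scaleC c (x * y)"
    and mult_scaleC_right: "x * scaleC c y = scaleC c (x * y)"

definition clinear_map :: "('a::complex_banach_algebra \<Rightarrow> 'a) \<Rightarrow> bool" where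
  "clinear_map T \<longleftrightarrow> (\<forall>x y. T (x + y) = T x + T y) \<and> (\<forall>c x. T (scaleC c x) = scaleC c (T x))"

definition is_derivation :: "('a::complex_banach_algebra \<Rightarrow> 'a) \<Rightarrow> bool" where
  "is_derivation d \<longleftrightarrow> clinear_map d \<and> (\<forall>a b. d (a * b) = d a * b + a * d b)"

definition is_generalized_derivation :: "('a::complex_banach_algebra \<Rightarrow> 'a) \<Rightarrow> bool" where
  "is_generalized_derivation \<delta> \<longleftrightarrow> clinear_map \<delta> \<and>
     (\<exists>d. is_derivation d \<and> (\<forall>a b. \<delta> (a * b) = a * \<delta> b + d a * b))"

text \<open>Quasi-invertibility: with the circle operation a o b = a + b - ab, an element a is
  quasi-invertible iff 1 - a is invertible in the unitization.\<close>
definition quasi_invertible :: "'a::complex_banach_algebra \<Rightarrow> bool" where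
  "quasi_invertible a \<longleftrightarrow> (\<exists>b. a + b - a * b = 0 \<and> b + a - b * a = 0)"

text \<open>Spectrum of a, computed in the unitization A+ = A + C:
  0 always belongs to it, and for l \<noteq> 0, l - a is invertible in A+ iff a/l is quasi-invertible.\<close>
definition spectrum :: "'a::complex_banach_algebra \<Rightarrow> complex set" where
  "spectrum a = {l. l = 0 \<or> \<not> quasi_invertible (scaleC (1 / l) a)}"

definition spectral_radius :: "'a::complex_banach_algebra \<Rightarrow> real" where
  "spectral_radius a = Sup (cmod ` spectrum a)"

definition spectrally_bounded :: "('a::complex_banach_algebra \<Rightarrow> 'a) \<Rightarrow> bool" where
  "spectrally_bounded T \<longleftrightarrow> clinear_map T \<and>
     (\<exists>M\<ge>0. \<forall>a. spectral_radius (T a) \<le> M * spectral_radius a)"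

text \<open>Jacobson radical: intersection of all maximal modular left ideals
  (the whole algebra if there are none).\<close>
definition left_ideal :: "'a::complex_banach_algebra set \<Rightarrow> bool" where
  "left_ideal L \<longleftrightarrow> 0 \<in> L \<and> (\<forall>x\<in>L. \<forall>y\<in>L. x + y \<in> L) \<and> (\<forall>c. \<forall>x\<in>L. scaleC c x \<in> L)
     \<and> (\<forall>a. \<forall>x\<in>L. a * x \<in> L)"

definition modular_left_ideal :: "'a::complex_banach_algebra set \<Rightarrow> bool" where
  "modular_left_ideal L \<longleftrightarrow> left_ideal L \<and> (\<exists>u. \<forall>x. x - x * u \<in> L)"

definition maximal_modular_left_ideal :: "'a::complex_banach_algebra set \<Rightarrow> bool" where
  "maximal_modular_left_ideal L \<longleftrightarrow> modular_left_ideal L \<and> L \<noteq> UNIV \<and>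
     (\<forall>J. left_ideal J \<and> L \<subseteq> J \<and> J \<noteq> UNIV \<longrightarrow> J = L)"

definition jacobson_radical :: "'a::complex_banach_algebra set" where
  "jacobson_radical = \<Inter> {L. maximal_modular_left_ideal L}"

definition right_annihilator :: "'a::complex_banach_algebra set" where
  "right_annihilator = {c. \<forall>a. a * c = 0}"

end

theory Submission
  imports Defs
begin

text \<open>Let \<open>e\<close> be a right identity. Then \<open>\<delta> a = a * \<delta> e + d a\<close>, and since \<open>A\<close> modulo its radical is
  commutative, the nonzero spectral values of an element are its values under characters of \<open>A\<close>.
  So it suffices that every character \<open>\<phi>\<close> kills the range of \<open>d\<close>, for then
  \<open>\<phi> (\<delta> a) = \<phi> (\<delta> e) * \<phi> a\<close> and \<open>M = norm (\<delta> e)\<close> works.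

  This is the theorem of Johnson and Singer--Wermer. A gliding hump shows that only finitely many
  \<open>\<phi> \<circ> d\<close> are discontinuous. If these were needed to separate points modulo the radical, there would be an element
  supported at a single discontinuous character \<open>\<psi>\<close>, which forces \<open>\<psi> \<circ> d = 0\<close>; hence the characters with
  \<open>\<phi> \<circ> d\<close> continuous separate points modulo \<open>{x. e * x = 0}\<close>, the radical, and \<open>x \<mapsto> e * d x\<close> is
  bounded by the closed graph theorem. Finally, for \<open>\<phi> a = 0\<close>, \<open>\<phi> (d\<^sup>n (a\<^sup>n)) = n! (\<phi> (d a))\<^sup>n\<close> grows
  at most geometrically in \<open>n\<close>, so \<open>\<phi> (d a) = 0\<close>.\<close>

section \<open>The closed graph theorem\<close>

text \<open>Baire makes some \<open>S n\<close> dense in a ball. Correcting an error that halves at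
  each stage writes \<open>x\<close> as a series with controlled images, and \<open>closed\<close>
  identifies the sum of these images with \<open>T x\<close>.\<close>

lemma closed_graph_bounded:
  fixes T :: "'a::banach \<Rightarrow> 'b::banach"
  assumes "linear T"
    and closed: "\<And>X w. X \<longlonglongrightarrow> 0 \<Longrightarrow> (\<lambda>n. T (X n)) \<longlonglongrightarrow> w \<Longrightarrow> w = 0"
  shows "\<exists>C\<ge>0. \<forall>x. norm (T x) \<le> C * norm x"
proof -
  interpret T: linear T by fact
  define S where "S n = {x. norm (T x) \<le> real n}" for n :: nat
  have "\<exists>n. interior (closure (S n)) \<noteq> {}"
  proof (rule ccontr)
    assume "\<not> ?thesis"
    then have "euclidean interior_of \<Union>(range (\<lambda>n. closure (S n))) = {}"
      by (intro Baire_category_alt) (auto simp: completely_metrizable_space_euclidean)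
    moreover have "x \<in> \<Union>(range (\<lambda>n. closure (S n)))" for x
    proof -
      obtain n where "norm (T x) \<le> real n" using real_arch_simple by blast
      then show ?thesis using closure_subset by (force simp: S_def)
    qed
    then have "\<Union>(range (\<lambda>n. closure (S n))) = UNIV" by blast
    ultimately show False by simp
  qed
  then obtain n x0 r where r: "r > 0" and ball: "ball x0 r \<subseteq> closure (S n)"
    by (metis all_not_in_conv mem_interior)
  \<comment> \<open>A small \<open>h\<close> is the difference of two points of the ball, whence the
    factor 2.\<close>
  have approx: "\<exists>z. norm (h - z) < \<epsilon> \<and> norm (T z) \<le> 2 * real n" if "norm h < r" "\<epsilon> > 0" for h \<epsilon>
  proof -
    have "x0 + h \<in> closure (S n)" "x0 \<in> closure (S n)"
      using that r ball by (auto simp: subset_iff dist_norm)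
    then obtain u v where uv: "u \<in> S n" "dist u (x0 + h) < \<epsilon>/2" "v \<in> S n" "dist v x0 < \<epsilon>/2"
      using \<open>\<epsilon> > 0\<close> by (meson closure_approachable half_gt_zero)
    have "norm (h - (u - v)) = norm ((v - x0) - (u - (x0 + h)))" by (simp add: algebra_simps)
    also have "\<dots> < \<epsilon>" using uv norm_triangle_ineq4[of "v - x0" "u - (x0 + h)"] by (simp add: dist_norm)
    finally have "norm (h - (u - v)) < \<epsilon>" .
    moreover have "norm (T (u - v)) \<le> 2 * real n"
      using uv norm_triangle_ineq4[of "T u" "T v"] by (simp add: T.diff S_def)
    ultimately show ?thesis by blast
  qed
  define K where "K = 4 * real n / r"
  have K0: "K \<ge> 0" using r by (simp add: K_def)
  have "\<exists>z. norm (x - z) \<le> norm x / 2 \<and> norm (T z) \<le> K * norm x" for x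
  proof (cases "x = 0")
    case True
    then show ?thesis by (intro exI[of _ 0]) (simp add: T.zero)
  next
    case False
    \<comment> \<open>Scaling by \<open>c\<close> gives norm \<open>r/2\<close>, so an error of
      \<open>r/4\<close> is at most half the norm after scaling back.\<close>
    define c where "c = r / (2 * norm x)"
    have c: "c > 0" using r False by (simp add: c_def)
    have "norm (c *\<^sub>R x) < r" using r False by (simp add: c_def)
    then obtain z where z: "norm (c *\<^sub>R x - z) < r/4" "norm (T z) \<le> 2 * real n"
      using approx[of "c *\<^sub>R x" "r/4"] r by auto
    have "x - (1/c) *\<^sub>R z = (1/c) *\<^sub>R (c *\<^sub>R x - z)"
      using c by (simp add: scaleR_diff_right)
    then have "norm (x - (1/c) *\<^sub>R z) = norm (c *\<^sub>R x - z) / c"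
      using c by simp
    also have "\<dots> \<le> (r/4) / c" using z c by (intro divide_right_mono) auto
    also have "\<dots> = norm x / 2" using r False by (simp add: c_def field_simps)
    finally have "norm (x - (1/c) *\<^sub>R z) \<le> norm x / 2" .
    moreover have "norm (T ((1/c) *\<^sub>R z)) \<le> K * norm x"
    proof -
      have "norm (T ((1/c) *\<^sub>R z)) = norm (T z) / c" using c by (simp add: T.scaleR)
      also have "\<dots> \<le> (2 * real n) / c" using z c by (intro divide_right_mono) auto
      also have "\<dots> = K * norm x" using r False by (simp add: c_def K_def field_simps)
      finally show ?thesis .
    qed
    ultimately show ?thesis by blast
  qed
  then obtain f where f: "\<And>x. norm (x - f x) \<le> norm x / 2" "\<And>x. norm (T (f x)) \<le> K * norm x"
    by metis
  have "norm (T x) \<le> 2 * K * norm x" for x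
  proof -
    \<comment> \<open>\<open>y k\<close> is what remains after \<open>k\<close> corrections, so the
      images of the corrections telescope.\<close>
    define y where "y k = ((\<lambda>v. v - f v) ^^ k) x" for k
    have y_Suc: "y (Suc k) = y k - f (y k)" for k by (simp add: y_def)
    have y_bound: "norm (y k) \<le> norm x * (1/2)^k" for k
    proof (induction k)
      case 0 show ?case by (simp add: y_def)
    next
      case (Suc k)
      then show ?case using f(1)[of "y k"] by (simp add: y_Suc)
    qed
    have geo: "(\<lambda>k. K * norm x * (1/2)^k) sums (K * norm x * 2)"
      using sums_mult[OF geometric_sums[of "1/2::real"], of "K * norm x"] by simp
    have Tf_bound: "norm (T (f (y k))) \<le> K * norm x * (1/2)^k" for k
      using f(2)[of "y k"] mult_left_mono[OF y_bound K0, of k] by (simp add: mult.assoc)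
    have summ: "summable (\<lambda>k. T (f (y k)))"
      by (rule summable_comparison_test'[OF sums_summable[OF geo], of 0]) (use Tf_bound in auto)
    define w where "w = (\<Sum>k. T (f (y k)))"
    have "norm w \<le> (\<Sum>k. K * norm x * (1/2)^k)"
      unfolding w_def by (rule norm_suminf_le[OF Tf_bound sums_summable[OF geo]])
    then have w: "norm w \<le> 2 * K * norm x" using geo by (simp add: sums_iff)
    have partial: "(\<Sum>k<m. T (f (y k))) = T x - T (y m)" for m
      by (induction m) (simp_all add: y_def T.diff T.zero)
    have "(\<lambda>m. T x - T (y m)) \<longlonglongrightarrow> w"
      using summable_LIMSEQ[OF summ] by (simp add: partial w_def)
    then have "(\<lambda>m. T x - (T x - T (y m))) \<longlonglongrightarrow> T x - w"
      by (intro tendsto_intros)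
    then have "(\<lambda>m. T (y m)) \<longlonglongrightarrow> T x - w" by simp
    moreover have "y \<longlonglongrightarrow> 0"
    proof (rule Lim_null_comparison)
      show "\<forall>\<^sub>F k in sequentially. norm (y k) \<le> norm x * (1/2)^k" using y_bound by simp
      show "(\<lambda>k. norm x * (1/2)^k) \<longlonglongrightarrow> 0"
        using tendsto_mult_right_zero[OF LIMSEQ_realpow_zero[of "1/2"]] by simp
    qed
    ultimately have "T x - w = 0" using closed by blast
    then show ?thesis using w by simp
  qed
  then show ?thesis using K0 by (intro exI[of _ "2 * K"]) auto
qed

section \<open>Quasi-inverses\<close>

lemma scaleC_zero_left [simp]: "scaleC 0 (x::'a::complex_banach_algebra) = 0"
  using scaleC_of_real[of 0 x] by simp

lemma scaleC_zero_right [simp]: "scaleC c (0::'a::complex_banach_algebra) = 0"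
  using scaleC_add_right[of c "0::'a" 0] by simp

lemma scaleC_minus_right: "scaleC c (- x) = - scaleC c (x::'a::complex_banach_algebra)"
  using scaleC_add_right[of c x "- x"] by (simp add: eq_neg_iff_add_eq_0 add.commute)

lemma scaleC_minus_left: "scaleC (- c) x = - scaleC c (x::'a::complex_banach_algebra)"
  using scaleC_add_left[of c "- c" x] by (simp add: eq_neg_iff_add_eq_0 add.commute)

lemma scaleC_diff_right: "scaleC c (x - y) = scaleC c x - scaleC c (y::'a::complex_banach_algebra)"
  using scaleC_add_right[of c x "- y"] by (simp add: scaleC_minus_right)

lemma scaleC_diff_left: "scaleC (c - d) x = scaleC c x - scaleC d (x::'a::complex_banach_algebra)"
  using scaleC_add_left[of c "- d" x] by (simp add: scaleC_minus_left)

lemma scaleC_sum_right: "scaleC c (\<Sum>i\<in>I. f i) = (\<Sum>i\<in>I. scaleC c (f i :: 'a::complex_banach_algebra))"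
  by (induction I rule: infinite_finite_induct) (simp_all add: scaleC_add_right)

lemma scaleC_sum_left: "scaleC (\<Sum>i\<in>I. f i) x = (\<Sum>i\<in>I. scaleC (f i) (x :: 'a::complex_banach_algebra))"
  by (induction I rule: infinite_finite_induct) (simp_all add: scaleC_add_left)

text \<open>The contractions \<open>b \<mapsto> x * b - x\<close> and
  \<open>b \<mapsto> b * x - x\<close> have fixed points, which are a right and a left
  quasi-inverse; associativity makes the two equal.\<close>

lemma quasi_invertible_norm_less_1:
  fixes x :: "'a::complex_banach_algebra"
  assumes "norm x < 1"
  shows "quasi_invertible x"
proof -
  have "\<exists>!b. x * b - x = b"
    by (rule banach_fix_type[of "norm x"])
       (use assms norm_mult_ineq[of x] in \<open>auto simp: dist_norm simp flip: right_diff_distrib\<close>)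
  then obtain b where b: "x * b - x = b" by blast
  have "\<exists>!b. b * x - x = b"
    by (rule banach_fix_type[of "norm x"])
       (use assms norm_mult_ineq[of _ x] in \<open>auto simp: dist_norm mult.commute[of "norm x"] simp flip: left_diff_distrib\<close>)
  then obtain c where c: "c * x - x = c" by blast
  have "c * x * b = c * b + x * b" using c by (metis diff_add_cancel distrib_right)
  moreover have "c * (x * b) = c * b + c * x" using b by (metis diff_add_cancel distrib_left)
  ultimately have "x * b = c * x" by (simp add: mult.assoc)
  then have "b = c" using b c by metis
  then have "x + b - x * b = 0" "b + x - b * x = 0"
    using b c by (simp_all add: algebra_simps)
  then show ?thesis unfolding quasi_invertible_def by blast
qed

lemma cmod_le_norm_of_spectrum:
  fixes a :: "'a::complex_banach_algebra"
  assumes "l \<in> spectrum a"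
  shows "cmod l \<le> norm a"
proof (rule ccontr)
  assume *: "\<not> ?thesis"
  then have l: "l \<noteq> 0" by auto
  then have "norm (scaleC (1 / l) a) < 1"
    using * by (simp add: norm_scaleC norm_divide)
  then show False
    using assms l quasi_invertible_norm_less_1 by (auto simp: spectrum_def)
qed

lemma cmod_le_spectral_radius:
  assumes "l \<in> spectrum a"
  shows "cmod l \<le> spectral_radius a"
  unfolding spectral_radius_def using assms cmod_le_norm_of_spectrum
  by (intro cSup_upper bdd_aboveI[of _ "norm a"]) auto

lemma spectral_radius_nonneg: "0 \<le> spectral_radius a"
  using cmod_le_spectral_radius[of 0 a] by (simp add: spectrum_def)

lemma spectral_radius_le:
  assumes "\<And>l. l \<in> spectrum a \<Longrightarrow> cmod l \<le> M"
  shows "spectral_radius a \<le> M"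
  unfolding spectral_radius_def using assms
  by (intro cSup_least) (auto simp: spectrum_def)

section \<open>The Gelfand--Mazur theorem for a quotient algebra\<close>

text \<open>Serves \<open>N_mult\<close>: an infimum is approached only by numbers strictly above
  it.\<close>

lemma le_mult_if_le_mult_greater:
  fixes n a b :: real
  assumes "\<And>s t. a < s \<Longrightarrow> b < t \<Longrightarrow> n \<le> s * t"
  shows "n \<le> a * b"
proof -
  have "((\<lambda>h. (a + h) * (b + h)) \<longlongrightarrow> (a + 0) * (b + 0)) (at_right 0)"
    by (intro tendsto_intros)
  moreover have "\<forall>\<^sub>F h in at_right 0. n \<le> (a + h) * (b + h)"
    using eventually_at_right_less by (rule eventually_mono) (auto intro: assms)
  ultimately have "n \<le> (a + 0) * (b + 0)"
    by (rule tendsto_lowerbound) simp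
  then show ?thesis by simp
qed

lemma cis_root_unity: "n > 0 \<Longrightarrow> cis (2 * pi / real n) ^ n = 1"
  by (simp add: Complex.DeMoivre)

text \<open>A geometric sum whose ratio is an \<open>n\<close>-th root of unity, different from 1
  because \<open>n\<close> does not divide \<open>m\<close>.\<close>

lemma sum_powers_root_unity:
  assumes "0 < m" "m < n"
  shows "(\<Sum>k<n. (cis (2 * pi / real n) ^ k) ^ m) = 0"
proof -
  define w where "w = cis (2 * pi / real n) ^ m"
  have "w \<noteq> 1"
  proof
    assume "w = 1"
    have "exp (2 * of_real pi * \<i> * of_nat m / of_nat n) = w"
      by (simp add: w_def cis_conv_exp mult_ac flip: exp_of_nat_mult)
    then have "n dvd m"
      using \<open>w = 1\<close> complex_root_unity_eq_1[of n m] assms by simp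
    then show False using assms by (simp add: nat_dvd_not_less)
  qed
  moreover have "w ^ n = 1"
    using assms cis_root_unity[of n] by (metis w_def gr_implies_not0 neq0_conv power_commutes power_mult mult.commute power_one)
  ultimately have "(\<Sum>k<n. w ^ k) = 0"
    using geometric_sum[of w n] by simp
  then show ?thesis by (simp add: w_def mult.commute flip: power_mult)
qed

text \<open>Models the algebra modulo \<open>L\<close> by congruences between representatives
  instead of a quotient type. Commutators in \<open>L\<close> make \<open>L\<close> two-sided and
  turn the right identity \<open>e\<close> into an identity modulo \<open>L\<close>.\<close>

locale commutative_unital_quotient =
  fixes L :: "'a::complex_banach_algebra set" and e :: 'a
  assumes left_ideal: "left_ideal L"
    and right_identity: "x * e = x"
    and commutator_in: "x * y - y * x \<in> L"
    and e_notin: "e \<notin> L"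
begin

definition eqv :: "'a \<Rightarrow> 'a \<Rightarrow> bool" (infix \<open>\<doteq>\<close> 50) where
  "x \<doteq> y \<longleftrightarrow> x - y \<in> L"

text \<open>The quotient seminorm, evaluated on representatives.\<close>

definition N :: "'a \<Rightarrow> real" where
  "N x = infdist x L"

text \<open>The type class provides no unit, so powers start at \<open>e\<close>.\<close>

primrec pow :: "'a \<Rightarrow> nat \<Rightarrow> 'a" where
  "pow x 0 = e"
| "pow x (Suc n) = x * pow x n"

lemma L_zero: "0 \<in> L"
  and L_add: "x \<in> L \<Longrightarrow> y \<in> L \<Longrightarrow> x + y \<in> L"
  and L_scaleC: "x \<in> L \<Longrightarrow> scaleC c x \<in> L"
  and L_mult_left: "x \<in> L \<Longrightarrow> a * x \<in> L"
  using left_ideal by (auto simp: left_ideal_def)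

lemma L_minus: "x \<in> L \<Longrightarrow> - x \<in> L"
  using L_scaleC[of x "-1"] by (simp add: scaleC_minus_left scaleC_one)

lemma L_diff: "x \<in> L \<Longrightarrow> y \<in> L \<Longrightarrow> x - y \<in> L"
  using L_add[of x "- y"] L_minus by simp

lemma L_mult_right: "x \<in> L \<Longrightarrow> x * a \<in> L"
  using L_add[OF L_mult_left commutator_in, of x a x a] by simp

lemma eqv_refl [simp]: "x \<doteq> x"
  by (simp add: eqv_def L_zero)

lemma eqv_sym: "x \<doteq> y \<Longrightarrow> y \<doteq> x"
  unfolding eqv_def using L_minus by fastforce

lemma eqv_trans [trans]: "x \<doteq> y \<Longrightarrow> y \<doteq> z \<Longrightarrow> x \<doteq> z"
  unfolding eqv_def using L_add[of "x - y" "y - z"] by simp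

lemma eqv_add: "x \<doteq> x' \<Longrightarrow> y \<doteq> y' \<Longrightarrow> x + y \<doteq> x' + y'"
  unfolding eqv_def using L_add[of "x - x'" "y - y'"] by (simp add: algebra_simps)

lemma eqv_diff: "x \<doteq> x' \<Longrightarrow> y \<doteq> y' \<Longrightarrow> x - y \<doteq> x' - y'"
  unfolding eqv_def using L_diff[of "x - x'" "y - y'"] by (simp add: algebra_simps)

lemma eqv_scaleC: "x \<doteq> x' \<Longrightarrow> scaleC c x \<doteq> scaleC c x'"
  unfolding eqv_def using L_scaleC[of "x - x'" c] by (simp add: scaleC_diff_right)

lemma eqv_mult: "x \<doteq> x' \<Longrightarrow> y \<doteq> y' \<Longrightarrow> x * y \<doteq> x' * y'"
  unfolding eqv_def
  using L_add[OF L_mult_right[of "x - x'" y] L_mult_left[of "y - y'" x']] by (simp add: algebra_simps)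

lemma eqv_sum: "(\<And>i. i \<in> I \<Longrightarrow> f i \<doteq> g i) \<Longrightarrow> (\<Sum>i\<in>I. f i) \<doteq> (\<Sum>i\<in>I. g i)"
  by (induction I rule: infinite_finite_induct) (auto intro: eqv_add)

lemma eqv_commute: "x * y \<doteq> y * x"
  by (simp add: eqv_def commutator_in)

lemma eqv_left_identity: "e * x \<doteq> x"
  using eqv_commute[of e x] by (simp add: right_identity)

lemma N_le: "l \<in> L \<Longrightarrow> N x \<le> norm (x - l)"
  unfolding N_def by (metis infdist_le dist_norm)

lemma N_lessD:
  assumes "N x < s"
  obtains l where "l \<in> L" "norm (x - l) < s"
proof -
  have "L \<noteq> {}" using L_zero by blast
  then have "(INF l\<in>L. dist x l) < s" using assms by (simp add: N_def infdist_notempty)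
  then obtain l where "l \<in> L" "dist x l < s"
    using \<open>L \<noteq> {}\<close> by (subst (asm) cINF_less_iff) (auto intro: bdd_belowI[of _ 0])
  then show ?thesis using that by (simp add: dist_norm)
qed

lemma N_nonneg [simp]: "0 \<le> N x"
  by (simp add: N_def infdist_nonneg)

lemma N_eqv_le: assumes "x \<doteq> y" shows "N x \<le> N y"
proof (rule dense_ge)
  fix s assume "N y < s"
  then obtain l where l: "l \<in> L" "norm (y - l) < s" by (rule N_lessD)
  have "N x \<le> norm (x - (x - y + l))"
    using assms l by (intro N_le L_add) (auto simp: eqv_def)
  then show "N x \<le> s" using l by simp
qed

lemma N_cong: "x \<doteq> y \<Longrightarrow> N x = N y"
  using N_eqv_le eqv_sym by (metis order_antisym)

lemma N_add: "N (x + y) \<le> N x + N y"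
proof (rule field_le_epsilon)
  fix \<epsilon> :: real assume "0 < \<epsilon>"
  then have "N x < N x + \<epsilon>/2" "N y < N y + \<epsilon>/2" by auto
  then obtain l m where l: "l \<in> L" "norm (x - l) < N x + \<epsilon>/2" and m: "m \<in> L" "norm (y - m) < N y + \<epsilon>/2"
    by (metis N_lessD)
  have "N (x + y) \<le> norm (x + y - (l + m))" by (intro N_le L_add l m)
  also have "\<dots> \<le> norm (x - l) + norm (y - m)"
    using norm_triangle_ineq[of "x - l" "y - m"] by (simp add: algebra_simps)
  finally show "N (x + y) \<le> N x + N y + \<epsilon>" using l m by simp
qed

lemma N_zero [simp]: "N 0 = 0"
  by (simp add: N_def L_zero)

lemma N_scaleC: "N (scaleC c x) \<le> cmod c * N x"
proof (cases "c = 0")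
  case True then show ?thesis by simp
next
  case False
  have "N (scaleC c x) / cmod c \<le> N x"
  proof (rule dense_ge)
    fix s assume "N x < s"
    then obtain l where l: "l \<in> L" "norm (x - l) < s" by (rule N_lessD)
    have "N (scaleC c x) \<le> norm (scaleC c x - scaleC c l)" by (intro N_le L_scaleC l)
    also have "\<dots> = cmod c * norm (x - l)" by (simp add: norm_scaleC flip: scaleC_diff_right)
    also have "\<dots> \<le> cmod c * s" using l by (intro mult_left_mono) auto
    finally show "N (scaleC c x) / cmod c \<le> s" using False by (simp add: field_simps)
  qed
  then show ?thesis using False by (simp add: field_simps)
qed

lemma N_minus: "N (- x) = N x"
  using N_scaleC[of "-1" x] N_scaleC[of "-1" "- x"] by (simp add: scaleC_minus_left scaleC_one)

lemma N_diff: "N (x - y) \<le> N x + N y"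
  using N_add[of x "- y"] by (simp add: N_minus)

lemma N_sum: "N (\<Sum>i\<in>I. f i) \<le> (\<Sum>i\<in>I. N (f i))"
proof (induction I rule: infinite_finite_induct)
  case (insert i I)
  then show ?case using N_add[of "f i" "sum f I"] by simp
qed auto

lemma N_mult: "N (x * y) \<le> N x * N y"
proof (rule le_mult_if_le_mult_greater)
  fix s t assume "N x < s" "N y < t"
  then obtain l m where l: "l \<in> L" "norm (x - l) < s" and m: "m \<in> L" "norm (y - m) < t"
    by (metis N_lessD)
  have "(x - l) * (y - m) \<doteq> x * y"
    by (intro eqv_mult) (auto simp: eqv_def l m L_minus)
  then have "N (x * y) = N ((x - l) * (y - m))" by (simp add: N_cong)
  also have "\<dots> \<le> norm ((x - l) * (y - m))" using N_le[OF L_zero] by simp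
  also have "\<dots> \<le> norm (x - l) * norm (y - m)" by (rule norm_mult_ineq)
  also have "\<dots> \<le> s * t"
    using l m norm_ge_zero[of "x - l"] norm_ge_zero[of "y - m"] by (intro mult_mono) linarith+
  finally show "N (x * y) \<le> s * t" .
qed

text \<open>If \<open>e - l\<close> had norm below 1 for some \<open>l\<close> in \<open>L\<close>,
  it would have a quasi-inverse \<open>w\<close>. Then \<open>w * l = - (e - l)\<close> would lie in
  \<open>L\<close>, and so would \<open>e\<close>.\<close>

lemma N_e: "1 \<le> N e"
proof (rule ccontr)
  assume "\<not> 1 \<le> N e"
  then obtain l where l: "l \<in> L" "norm (e - l) < 1" using N_lessD[of e 1] by auto
  define z where "z = e - l"
  obtain w where w: "w + z - w * z = 0"
    using quasi_invertible_norm_less_1[of z] l by (auto simp: z_def quasi_invertible_def)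
  have "w * l = w - w * z" by (simp add: z_def right_diff_distrib right_identity)
  then have "w * l = - z" using w by (simp add: eq_neg_iff_add_eq_0 add_diff_eq add.commute)
  then have "z \<in> L" using L_minus[OF L_mult_left[OF l(1), of w]] by simp
  then have "e \<in> L" using L_add[OF _ l(1), of z] by (simp add: z_def)
  then show False using e_notin by simp
qed

section \<open>Powers and resolvents modulo \<open>L\<close>\<close>

lemma pow_add: "pow x m * pow x n \<doteq> pow x (m + n)"
  by (induction m) (auto simp: eqv_left_identity mult.assoc intro: eqv_mult)

text \<open>Stated for \<open>Suc k\<close> since at exponent 0 the left side would be
  \<open>N e\<close>, which may exceed 1.\<close>

lemma pow_mult_N: "N (pow x (n * Suc k)) \<le> N (pow x n) ^ Suc k"
proof (induction k)
  case (Suc k)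
  have "N (pow x (n * Suc (Suc k))) = N (pow x n * pow x (n * Suc k))"
    using N_cong[OF pow_add[of x n "n * Suc k"]] by simp
  also have "\<dots> \<le> N (pow x n) * N (pow x (n * Suc k))" by (rule N_mult)
  also have "\<dots> \<le> N (pow x n) * N (pow x n) ^ Suc k" by (intro mult_left_mono Suc) simp
  finally show ?case by simp
qed simp

lemma N_pow_le: "N (pow x n) \<le> N x ^ n * N e"
proof (induction n)
  case (Suc n)
  have "N (pow x (Suc n)) \<le> N x * N (pow x n)" by (simp add: N_mult)
  also have "\<dots> \<le> N x * (N x ^ n * N e)" by (intro mult_left_mono Suc) simp
  finally show ?case by (simp add: mult.assoc)
qed simp

lemma pow_mult_distrib:
  assumes "x * z \<doteq> e"
  shows "pow x n * pow z n \<doteq> e"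
proof (induction n)
  case 0 show ?case by (simp add: right_identity)
next
  case (Suc n)
  have "pow x (Suc n) * pow z (Suc n) = x * ((pow x n * z) * pow z n)" by (simp add: mult.assoc)
  also have "\<dots> \<doteq> x * ((z * pow x n) * pow z n)" by (intro eqv_mult eqv_commute eqv_refl)
  also have "\<dots> = (x * z) * (pow x n * pow z n)" by (simp add: mult.assoc)
  also have "\<dots> \<doteq> e * e" by (intro eqv_mult assms Suc)
  finally show ?case by (simp add: right_identity)
qed

text \<open>The telescoping factorization of \<open>c ^ n - y ^ n\<close>; it is a congruence
  because \<open>e\<close> acts as a left identity only modulo \<open>L\<close>.\<close>

lemma geometric_factorization:
  "(scaleC c e - y) * (\<Sum>j<n. scaleC (c ^ (n - Suc j)) (pow y j)) \<doteq> scaleC (c ^ n) e - pow y n"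
proof (induction n)
  case 0 show ?case by (simp add: scaleC_one)
next
  case (Suc n)
  define H where "H = (\<Sum>j<n. scaleC (c ^ (n - Suc j)) (pow y j))"
  have "(\<Sum>j<n. scaleC (c ^ (Suc n - Suc j)) (pow y j)) = scaleC c H"
    unfolding H_def scaleC_sum_right
    by (intro sum.cong refl) (simp add: scaleC_scaleC Suc_diff_Suc flip: power_Suc)
  then have "(scaleC c e - y) * (\<Sum>j<Suc n. scaleC (c ^ (Suc n - Suc j)) (pow y j))
      = scaleC c ((scaleC c e - y) * H) + (scaleC c (e * pow y n) - y * pow y n)"
    by (simp add: scaleC_one distrib_left left_diff_distrib mult_scaleC_left mult_scaleC_right)
  also have "\<dots> \<doteq> scaleC c (scaleC (c ^ n) e - pow y n) + (scaleC c (pow y n) - y * pow y n)"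
    using Suc unfolding H_def by (intro eqv_add eqv_scaleC eqv_diff eqv_left_identity eqv_refl)
  also have "\<dots> = scaleC (c ^ Suc n) e - pow y (Suc n)"
    by (simp add: scaleC_diff_right scaleC_scaleC)
  finally show ?case .
qed

text \<open>Averaging \<open>c / (c - y)\<close> over the \<open>n\<close>-th roots of \<open>r ^ n\<close> yields the inverse of
  \<open>1 - (y / r) ^ n\<close>. As the resolvent is uniformly continuous on discs, this controls how the
  powers of \<open>y / r\<close> change with \<open>r\<close> (Rickart's proof, which needs no vector-valued Liouville theorem).\<close>

lemma resolvent_average:
  fixes Z :: "complex \<Rightarrow> 'a" and r :: real
  assumes Z: "\<And>c. (scaleC c e - y) * Z c \<doteq> e" and n: "n > 0"
  defines "\<mu> \<equiv> \<lambda>k. of_real r * cis (2 * pi / real n) ^ k"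
  shows "(scaleC (of_real r ^ n) e - pow y n) * scaleC (1 / of_nat n) (\<Sum>k<n. scaleC (\<mu> k) (Z (\<mu> k)))
     \<doteq> scaleC (of_real r ^ n) e"
proof -
  have mu_n: "\<mu> k ^ n = of_real r ^ n" for k
  proof -
    have "(cis (2 * pi / real n) ^ k) ^ n = (cis (2 * pi / real n) ^ n) ^ k"
      by (simp add: mult.commute flip: power_mult)
    then show ?thesis using n by (simp add: \<mu>_def power_mult_distrib cis_root_unity)
  qed
  let ?X = "scaleC (of_real r ^ n) e - pow y n"
  \<comment> \<open>\<open>Z c\<close> cancels the factor \<open>scaleC c e - y\<close> of
    \<open>?X\<close>, which leaves a polynomial in \<open>y\<close>.\<close>
  have one: "?X * scaleC (\<mu> k) (Z (\<mu> k)) \<doteq> (\<Sum>j<n. scaleC (\<mu> k ^ (n - j)) (pow y j))" for k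
  proof -
    define c where "c = \<mu> k"
    define H where "H = (\<Sum>j<n. scaleC (c ^ (n - Suc j)) (pow y j))"
    have "?X * scaleC c (Z c) = scaleC c ((scaleC (c ^ n) e - pow y n) * Z c)"
      by (simp add: mult_scaleC_right c_def mu_n)
    also have "\<dots> \<doteq> scaleC c (((scaleC c e - y) * H) * Z c)"
      unfolding H_def by (intro eqv_scaleC eqv_mult eqv_refl eqv_sym[OF geometric_factorization])
    also have "\<dots> \<doteq> scaleC c ((H * (scaleC c e - y)) * Z c)"
      by (intro eqv_scaleC eqv_mult eqv_refl eqv_commute)
    also have "\<dots> = scaleC c (H * ((scaleC c e - y) * Z c))" by (simp add: mult.assoc)
    also have "\<dots> \<doteq> scaleC c (H * e)" by (intro eqv_scaleC eqv_mult eqv_refl Z)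
    also have "\<dots> = (\<Sum>j<n. scaleC (c ^ (n - j)) (pow y j))"
      unfolding right_identity H_def scaleC_sum_right
      by (intro sum.cong refl) (simp add: scaleC_scaleC Suc_diff_Suc flip: power_Suc)
    finally show ?thesis by (simp add: c_def)
  qed
  have "?X * (\<Sum>k<n. scaleC (\<mu> k) (Z (\<mu> k))) \<doteq> (\<Sum>k<n. \<Sum>j<n. scaleC (\<mu> k ^ (n - j)) (pow y j))"
    unfolding sum_distrib_left by (intro eqv_sum one)
  also have "\<dots> = (\<Sum>j<n. scaleC (\<Sum>k<n. \<mu> k ^ (n - j)) (pow y j))"
    by (subst sum.swap) (simp add: scaleC_sum_left)
  \<comment> \<open>For \<open>0 < j < n\<close> the exponent \<open>n - j\<close> lies strictly
    between 0 and \<open>n\<close>, so the sum over the roots of unity vanishes.\<close>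
  also have "\<dots> = (\<Sum>j<n. if j = 0 then scaleC (of_nat n * of_real r ^ n) e else 0)"
  proof (intro sum.cong refl)
    fix j assume j: "j \<in> {..<n}"
    show "scaleC (\<Sum>k<n. \<mu> k ^ (n - j)) (pow y j) = (if j = 0 then scaleC (of_nat n * of_real r ^ n) e else 0)"
    proof (cases "j = 0")
      case True then show ?thesis by (simp add: mu_n)
    next
      case False
      then have "(\<Sum>k<n. \<mu> k ^ (n - j)) = of_real r ^ (n - j) * (\<Sum>k<n. (cis (2 * pi / real n) ^ k) ^ (n - j))"
        unfolding \<mu>_def sum_distrib_left by (intro sum.cong refl) (simp add: power_mult_distrib)
      also have "\<dots> = 0" using False j by (subst sum_powers_root_unity) auto
      finally show ?thesis using False by simp
    qed
  qed
  also have "\<dots> = scaleC (of_nat n * of_real r ^ n) e" using n by simp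
  finally have "scaleC (1 / of_nat n) (?X * (\<Sum>k<n. scaleC (\<mu> k) (Z (\<mu> k))))
      \<doteq> scaleC (1 / of_nat n) (scaleC (of_nat n * of_real r ^ n) e)"
    by (rule eqv_scaleC)
  then show ?thesis using n by (simp add: mult_scaleC_right scaleC_scaleC)
qed


text \<open>Otherwise the resolvent \<open>Z\<close> exists on the whole plane. The radii
  \<open>r\<close> exceeding the spectral radius of \<open>y\<close> modulo \<open>L\<close>
  (predicate \<open>P\<close>) can then be lowered by a uniform step, yet they stay above a positive
  bound because \<open>y\<close> is invertible modulo \<open>L\<close>; this is contradictory at
  their infimum.\<close>

lemma gelfand_mazur:
  assumes inverse: "\<And>x. x \<notin> L \<Longrightarrow> \<exists>z. x * z \<doteq> e"
  shows "\<exists>c. y - scaleC c e \<in> L"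
proof (rule ccontr)
  assume "\<not> ?thesis"
  then have "scaleC c e - y \<notin> L" for c using L_minus[of "scaleC c e - y"] by auto
  then have "\<exists>z. (scaleC c e - y) * z \<doteq> e" for c using inverse by blast
  then obtain Z where Z: "\<And>c. (scaleC c e - y) * Z c \<doteq> e" by metis
  have resolvent: "Z c - Z c' \<doteq> scaleC (c' - c) (Z c * Z c')" for c c'
  proof -
    have "Z c' \<doteq> e * Z c'" by (rule eqv_sym[OF eqv_left_identity])
    also have "\<dots> \<doteq> ((scaleC c e - y) * Z c) * Z c'" by (intro eqv_mult eqv_sym[OF Z] eqv_refl)
    also have "\<dots> \<doteq> (Z c * (scaleC c e - y)) * Z c'" by (intro eqv_mult eqv_commute eqv_refl)
    finally have 1: "Z c' \<doteq> (Z c * (scaleC c e - y)) * Z c'" .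
    have 2: "Z c \<doteq> Z c * ((scaleC c' e - y) * Z c')"
      using eqv_mult[OF eqv_refl[of "Z c"] eqv_sym[OF Z[of c']]] by (simp add: right_identity)
    have "Z c - Z c' \<doteq> Z c * ((scaleC c' e - y) * Z c') - (Z c * (scaleC c e - y)) * Z c'"
      by (intro eqv_diff 1 2)
    also have "\<dots> = (Z c * (scaleC (c' - c) e)) * Z c'"
      by (simp add: algebra_simps scaleC_diff_left)
    also have "\<dots> = scaleC (c' - c) (Z c * Z c')"
      by (simp add: mult_scaleC_right mult_scaleC_left right_identity)
    finally show ?thesis .
  qed
  have resolvent_N: "N (Z c - Z c') \<le> cmod (c' - c) * (N (Z c) * N (Z c'))" for c c'
  proof -
    have "N (Z c - Z c') = N (scaleC (c' - c) (Z c * Z c'))" by (rule N_cong[OF resolvent])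
    also have "\<dots> \<le> cmod (c' - c) * N (Z c * Z c')" by (rule N_scaleC)
    also have "\<dots> \<le> cmod (c' - c) * (N (Z c) * N (Z c'))" by (intro mult_left_mono N_mult) simp
    finally show ?thesis .
  qed
  have N_diff_ge: "N x \<le> N z + N (x - z)" for x z using N_add[of z "x - z"] by simp
  have "isCont (\<lambda>c. N (Z c)) c" for c
  proof -
    \<comment> \<open>Within this radius \<open>cmod (c' - c) * N (Z c)\<close> is at most 1/2, so
      the resolvent inequality gives \<open>N (Z c') \<le> 2 * N (Z c)\<close>. Adding 1 avoids
      division by zero.\<close>
    define h where "h = 1 / (2 * (N (Z c) + 1))"
    have h: "h > 0" by (simp add: h_def add_nonneg_pos)
    have *: "\<bar>N (Z c') - N (Z c)\<bar> \<le> 2 * (N (Z c))\<^sup>2 * cmod (c' - c)" if "dist c' c < h" for c'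
    proof -
      have "cmod (c' - c) * N (Z c) \<le> h * (N (Z c) + 1)"
        using that h by (intro mult_mono) (auto simp: dist_norm)
      also have "\<dots> = 1/2" using add_nonneg_pos[OF N_nonneg[of "Z c"] zero_less_one] by (simp add: h_def)
      finally have small: "cmod (c' - c) * N (Z c) \<le> 1/2" .
      have A: "N (Z c' - Z c) \<le> cmod (c' - c) * N (Z c) * N (Z c')"
        using resolvent_N[of c' c] by (simp add: norm_minus_commute mult_ac)
      also have "\<dots> \<le> 1/2 * N (Z c')" using small by (intro mult_right_mono) auto
      finally have "N (Z c') \<le> 2 * N (Z c)" using N_diff_ge[of "Z c'" "Z c"] by simp
      then have "cmod (c' - c) * N (Z c) * N (Z c') \<le> cmod (c' - c) * N (Z c) * (2 * N (Z c))"
        by (intro mult_left_mono) auto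
      then have "N (Z c' - Z c) \<le> 2 * (N (Z c))\<^sup>2 * cmod (c' - c)"
        using A by (simp add: power2_eq_square mult_ac)
      moreover have "N (Z c - Z c') = N (Z c' - Z c)" using N_minus[of "Z c' - Z c"] by simp
      ultimately show ?thesis
        using N_diff_ge[of "Z c'" "Z c"] N_diff_ge[of "Z c" "Z c'"] by linarith
    qed
    have "((\<lambda>c'. N (Z c') - N (Z c)) \<longlongrightarrow> 0) (at c)"
    proof (rule Lim_null_comparison)
      show "\<forall>\<^sub>F c' in at c. norm (N (Z c') - N (Z c)) \<le> 2 * (N (Z c))\<^sup>2 * cmod (c' - c)"
        unfolding eventually_at using h * by (auto simp: real_norm_def)
      show "((\<lambda>c'. 2 * (N (Z c))\<^sup>2 * cmod (c' - c)) \<longlongrightarrow> 0) (at c)"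
        by (rule tendsto_eq_intros refl)+ simp
    qed
    then show ?thesis unfolding isCont_def by (rule LIM_zero_cancel)
  qed
  then have cont: "continuous_on S (\<lambda>c. N (Z c))" for S
    by (simp add: continuous_at_imp_continuous_on)
  \<comment> \<open>Chosen so that \<open>P R\<close> holds with exponent 1.\<close>
  define R where "R = N y + 1"
  have R: "R > 0" by (simp add: R_def add_nonneg_pos)
  have "bounded ((\<lambda>c. N (Z c)) ` cball 0 R)"
    by (intro compact_imp_bounded compact_continuous_image cont compact_cball)
  then obtain M where M: "M > 0" "\<And>c. cmod c \<le> R \<Longrightarrow> N (Z c) \<le> M"
    unfolding bounded_pos by auto
  \<comment> \<open>A Lipschitz constant of \<open>c \<mapsto> scaleC c (Z c)\<close> on the disc of
    radius \<open>R\<close>; it passes to the averages \<open>A n\<close> uniformly in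
    \<open>n\<close>.\<close>
  define K where "K = M + R * (M * M)"
  have K: "K > 0" using M R by (simp add: K_def add_pos_pos)
  have lipschitz: "N (scaleC c (Z c) - scaleC c' (Z c')) \<le> K * cmod (c - c')"
    if "cmod c \<le> R" "cmod c' \<le> R" for c c'
  proof -
    have "scaleC c (Z c) - scaleC c' (Z c') = scaleC (c - c') (Z c) + scaleC c' (Z c - Z c')"
      by (simp add: scaleC_diff_left scaleC_diff_right)
    then have "N (scaleC c (Z c) - scaleC c' (Z c')) \<le> N (scaleC (c - c') (Z c)) + N (scaleC c' (Z c - Z c'))"
      using N_add by simp
    also have "\<dots> \<le> cmod (c - c') * N (Z c) + cmod c' * N (Z c - Z c')"
      by (intro add_mono N_scaleC)
    also have "\<dots> \<le> cmod (c - c') * M + R * (cmod (c' - c) * (M * M))"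
    proof -
      have "N (Z c) * N (Z c') \<le> M * M" using that M by (intro mult_mono) auto
      then have "N (Z c - Z c') \<le> cmod (c' - c) * (M * M)"
        by (intro order_trans[OF resolvent_N] mult_left_mono) auto
      then show ?thesis using that M R by (intro add_mono mult_mono) auto
    qed
    also have "\<dots> = K * cmod (c - c')" by (simp add: K_def norm_minus_commute algebra_simps)
    finally show ?thesis .
  qed
  define A where "A n r = scaleC (1 / of_nat n) (\<Sum>k<n. scaleC (of_real r * cis (2 * pi / real n) ^ k)
      (Z (of_real r * cis (2 * pi / real n) ^ k)))" for n :: nat and r :: real
  have A_lipschitz: "N (A n r - A n s) \<le> K * \<bar>r - s\<bar>" if "n > 0" "0 \<le> r" "r \<le> R" "0 \<le> s" "s \<le> R" for n r s
  proof -
    define w where "w k = cis (2 * pi / real n) ^ k" for k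
    have w: "cmod (w k) = 1" for k by (simp add: w_def norm_power)
    let ?g = "\<lambda>c. scaleC c (Z c)"
    have "A n r - A n s = scaleC (1 / of_nat n) (\<Sum>k<n. ?g (of_real r * w k) - ?g (of_real s * w k))"
      unfolding A_def w_def by (simp add: sum_subtractf scaleC_diff_right)
    then have "N (A n r - A n s) \<le> 1 / real n * N (\<Sum>k<n. ?g (of_real r * w k) - ?g (of_real s * w k))"
      using N_scaleC[of "1 / of_nat n" "\<Sum>k<n. ?g (of_real r * w k) - ?g (of_real s * w k)"]
      by (simp add: norm_divide)
    also have "\<dots> \<le> 1 / real n * (\<Sum>k<n. K * \<bar>r - s\<bar>)"
    proof (intro mult_left_mono order_trans[OF N_sum] sum_mono)
      fix k
      have "of_real r * w k - of_real s * w k = of_real (r - s) * w k" by (simp add: left_diff_distrib)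
      then have "cmod (of_real r * w k - of_real s * w k) = \<bar>r - s\<bar>" by (simp only: norm_mult w norm_of_real mult_1_right)
      then show "N (?g (of_real r * w k) - ?g (of_real s * w k)) \<le> K * \<bar>r - s\<bar>"
        using lipschitz[of "of_real r * w k" "of_real s * w k"] that by (simp add: norm_mult w)
    qed simp
    also have "\<dots> = K * \<bar>r - s\<bar>" using that by simp
    finally show ?thesis .
  qed
  define V where "V n r = scaleC (1 / of_real r ^ n) (pow y n)" for n and r :: real
  \<comment> \<open>\<open>V n r\<close> stands for the \<open>n\<close>-th power of
    \<open>y / r\<close>, and \<open>A n r\<close> inverts \<open>e - V n r\<close> modulo
    \<open>L\<close>.\<close>
  have A_V: "A n r - e \<doteq> V n r * A n r" if "n > 0" "r > 0" for n r
  proof -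
    have "scaleC (1 / of_real r ^ n) ((scaleC (of_real r ^ n) e - pow y n) * A n r)
        \<doteq> scaleC (1 / of_real r ^ n) (scaleC (of_real r ^ n) e)"
      unfolding A_def using resolvent_average[OF Z that(1), of r] by (rule eqv_scaleC)
    then have "e * A n r - V n r * A n r \<doteq> e"
      using that by (simp add: V_def left_diff_distrib scaleC_diff_right mult_scaleC_left scaleC_scaleC scaleC_one)
    then have "(A n r - e * A n r) + (e * A n r - V n r * A n r) \<doteq> 0 + e"
      by (intro eqv_add) (use eqv_sym[OF eqv_left_identity, of "A n r"] in \<open>auto simp: eqv_def\<close>)
    then show ?thesis by (simp add: eqv_def algebra_simps)
  qed
  have N_V: "N (V n r) \<le> N (pow y n) / r ^ n" if "r > 0" for n r
    using N_scaleC[of "1 / of_real r ^ n" "pow y n"] that by (simp add: V_def norm_divide norm_power)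
  have pow_V: "N (pow y n) \<le> r ^ n * N (V n r)" if "r > 0" for n r
    using N_scaleC[of "of_real r ^ n" "V n r"] that by (simp add: V_def scaleC_scaleC scaleC_one norm_power)
  define P where "P r \<longleftrightarrow> (\<exists>n>0. N (pow y n) < r ^ n)" for r :: real
  have small_power: "\<exists>m>0. N (pow y m) / s ^ m < \<epsilon>" if "P s" "s > 0" "\<epsilon> > 0" for s \<epsilon>
  proof -
    obtain n where n: "n > 0" "N (pow y n) < s ^ n" using \<open>P s\<close> by (auto simp: P_def)
    define q where "q = N (pow y n) / s ^ n"
    have q: "0 \<le> q" "q < 1" using n \<open>s > 0\<close> by (auto simp: q_def)
    then obtain k where "q ^ k < \<epsilon>" using real_arch_pow_inv[OF \<open>\<epsilon> > 0\<close>] by blast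
    moreover have "q ^ Suc k \<le> q ^ k" using q by (intro power_decreasing) auto
    ultimately have k: "q ^ Suc k < \<epsilon>" by simp
    have "N (pow y (n * Suc k)) / s ^ (n * Suc k) \<le> N (pow y n) ^ Suc k / s ^ (n * Suc k)"
      using \<open>s > 0\<close> by (intro divide_right_mono pow_mult_N) auto
    also have "\<dots> = q ^ Suc k" unfolding q_def power_divide power_mult ..
    finally show ?thesis using k n by (intro exI[of _ "n * Suc k"]) auto
  qed
  \<comment> \<open>Some power \<open>V n s\<close> is so small that \<open>A n s\<close> is within
    1/12 of \<open>e\<close>. The Lipschitz bound adds at most 1/4, so \<open>A n r\<close> is
    within 1/3 of \<open>e\<close>, and this forces \<open>N (V n r) \<le> 1/2\<close>.\<close>
  have step: "P r" if "P s" "0 < r" "r \<le> s" "s \<le> R" "K * (s - r) \<le> 1/4" for r s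
  proof -
    have E: "N e \<ge> 1" by (rule N_e)
    have "s > 0" using that by simp
    obtain n where n: "n > 0" "N (pow y n) / s ^ n < 1 / (13 * N e)"
      using small_power[OF \<open>P s\<close> \<open>s > 0\<close>, of "1 / (13 * N e)"] E by auto
    define v where "v = V n s"
    have "N v < 1 / (13 * N e)" using N_V[of s n] n that by (simp add: v_def)
    then have v: "N v * N e < 1/13" using E by (simp add: field_simps)
    have v': "N v < 1/13" using v mult_left_mono[OF E, of "N v"] by simp
    have "N (A n s - e) = N (v * A n s)" unfolding v_def using n that by (intro N_cong A_V) auto
    also have "\<dots> \<le> N v * N (A n s)" by (rule N_mult)
    also have "\<dots> \<le> N v * (N e + N (A n s - e))" by (intro mult_left_mono N_diff_ge) simp
    also have "\<dots> \<le> 1/13 + 1/13 * N (A n s - e)"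
      unfolding distrib_left using v v' by (intro add_mono mult_right_mono) auto
    finally have 1: "N (A n s - e) \<le> 1/12" by simp
    have "N (A n r - A n s) \<le> 1/4" using A_lipschitz[of n r s] n that by simp
    then have 2: "N (A n r - e) \<le> 1/3"
      using 1 N_add[of "A n r - A n s" "A n s - e"] by simp
    define u where "u = V n r"
    have "N (u * A n r) = N (A n r - e)" unfolding u_def using n that by (intro N_cong[symmetric] A_V) auto
    moreover have "u = u * A n r - u * (A n r - e)" by (simp add: right_diff_distrib right_identity)
    then have "N u \<le> N (u * A n r) + N (u * (A n r - e))" using N_diff by metis
    moreover have "N (u * (A n r - e)) \<le> N u * (1/3)"
      using N_mult[of u "A n r - e"] mult_left_mono[OF 2, of "N u"] by simp
    ultimately have "N u \<le> 1/2" using 2 by simp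
    then have "r ^ n * N u \<le> r ^ n * (1/2)" using that by (intro mult_left_mono) auto
    also have "\<dots> < r ^ n" using that by simp
    finally have "r ^ n * N u < r ^ n" .
    then have "N (pow y n) < r ^ n" using pow_V[of r n] \<open>0 < r\<close> unfolding u_def by linarith
    then show ?thesis using n by (auto simp: P_def)
  qed
  \<comment> \<open>An inverse of \<open>y\<close> modulo \<open>L\<close>. It gives
    \<open>1 \<le> N (pow y n) * N z ^ n\<close>, so \<open>P r\<close> fails for
    \<open>r \<le> 1 / N z\<close>.\<close>
  define z where "z = - Z 0"
  have yz: "y * z \<doteq> e" using Z[of 0] by (simp add: z_def)
  have z_pos: "N z > 0" and lower: "P r \<Longrightarrow> r > 0 \<Longrightarrow> 1 / N z < r" for r
  proof -
    have one: "1 \<le> N (pow y n) * N z ^ n" for n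
    proof -
      have "N e = N (pow y n * pow z n)" using N_cong[OF pow_mult_distrib[OF yz]] by simp
      also have "\<dots> \<le> N (pow y n) * N (pow z n)" by (rule N_mult)
      also have "\<dots> \<le> N (pow y n) * (N z ^ n * N e)" by (intro mult_left_mono N_pow_le) simp
      finally show ?thesis using N_e by (simp add: mult.assoc[symmetric] mult_le_cancel_right1)
    qed
    show zp: "N z > 0" using one[of 1] by (metis N_nonneg linorder_not_le mult_zero_right not_one_le_zero order_le_less power_one_right)
    show "1 / N z < r" if "P r" "r > 0"
    proof (rule ccontr)
      assume "\<not> ?thesis"
      then have "r * N z \<le> 1" using zp by (simp add: field_simps)
      then have "(r * N z) ^ n \<le> 1" for n using that zp by (intro power_le_one) auto
      moreover obtain n where "n > 0" "N (pow y n) < r ^ n" using \<open>P r\<close> by (auto simp: P_def)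
      then have "N (pow y n) * N z ^ n < (r * N z) ^ n" using zp by (simp add: power_mult_distrib)
      ultimately show False using one[of n] by (metis linorder_not_le order.trans)
    qed
  qed
  define S where "S = {r. 0 < r \<and> r \<le> R \<and> P r}"
  have "P R" unfolding P_def by (intro exI[of _ 1]) (simp add: R_def right_identity)
  then have S_ne: "S \<noteq> {}" using R by (auto simp: S_def)
  have S_bdd: "bdd_below S" by (rule bdd_belowI[of _ 0]) (auto simp: S_def)
  define r0 where "r0 = Inf S"
  have "1 / N z \<le> r0" unfolding r0_def using lower by (intro cInf_greatest S_ne) (auto simp: S_def less_imp_le)
  then have r0: "r0 > 0" using z_pos by (metis divide_pos_pos less_le_trans zero_less_one)
  define h where "h = min (1 / (4 * K)) r0"
  have h: "h > 0" using K r0 by (simp add: h_def)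
  then have "Inf S < r0 + h" by (simp add: r0_def)
  then obtain s where s: "s \<in> S" "s < r0 + h" using cInf_less_iff[OF S_ne S_bdd] by blast
  \<comment> \<open>Both candidates lie below \<open>r0\<close>, the second because
    \<open>h \<le> r0\<close>; taking \<open>s / 2\<close> into account keeps \<open>r\<close>
    positive.\<close>
  define r where "r = max (s - h) (s / 2)"
  have r: "0 < r" "r \<le> s" "r \<le> R" using s h by (auto simp: r_def S_def)
  have "K * (s - r) \<le> K * (1 / (4 * K))" using K by (intro mult_left_mono) (auto simp: r_def h_def)
  then have "P r" using step[of s r] s r K by (auto simp: S_def)
  then have "r \<in> S" using r by (simp add: S_def)
  then have "r0 \<le> r" unfolding r0_def using S_bdd by (rule cInf_lower)
  moreover have "r < r0" using s h by (auto simp: r_def h_def)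
  ultimately show False by simp
qed

end

section \<open>Characters\<close>

definition character :: "('a::complex_banach_algebra \<Rightarrow> complex) \<Rightarrow> bool" where
  "character \<phi> \<longleftrightarrow> (\<forall>x y. \<phi> (x + y) = \<phi> x + \<phi> y) \<and> (\<forall>c x. \<phi> (scaleC c x) = c * \<phi> x)
     \<and> (\<forall>x y. \<phi> (x * y) = \<phi> x * \<phi> y) \<and> (\<exists>x. \<phi> x \<noteq> 0)"

lemma character_add: "character \<phi> \<Longrightarrow> \<phi> (x + y) = \<phi> x + \<phi> y"
  and character_scaleC: "character \<phi> \<Longrightarrow> \<phi> (scaleC c x) = c * \<phi> x"
  and character_mult: "character \<phi> \<Longrightarrow> \<phi> (x * y) = \<phi> x * \<phi> y"
  by (simp_all add: character_def)

lemma character_zero: "character \<phi> \<Longrightarrow> \<phi> 0 = 0"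
  using character_scaleC[of \<phi> 0 0] by simp

lemma character_minus: "character \<phi> \<Longrightarrow> \<phi> (- x) = - \<phi> x"
  using character_scaleC[of \<phi> "-1" x] by (simp add: scaleC_minus_left scaleC_one)

lemma character_diff: "character \<phi> \<Longrightarrow> \<phi> (x - y) = \<phi> x - \<phi> y"
  using character_add[of \<phi> x "- y"] by (simp add: character_minus)

lemmas character_simps = character_add character_scaleC character_mult character_zero
  character_minus character_diff

text \<open>Applying \<open>\<phi>\<close> to the quasi-inverse equation of
  \<open>x / \<phi> x\<close> would yield 1 = 0.\<close>

lemma character_in_spectrum:
  assumes "character \<phi>"
  shows "\<phi> x \<in> spectrum x"
proof -
  have False if nz: "\<phi> x \<noteq> 0" and qi: "quasi_invertible (scaleC (1 / \<phi> x) x)"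
  proof -
    obtain w where "scaleC (1 / \<phi> x) x + w - scaleC (1 / \<phi> x) x * w = 0"
      using qi unfolding quasi_invertible_def by blast
    then have "\<phi> (scaleC (1 / \<phi> x) x + w - scaleC (1 / \<phi> x) x * w) = 0"
      by (simp add: character_zero assms)
    then show False using nz assms by (simp add: character_simps)
  qed
  then show ?thesis by (auto simp: spectrum_def)
qed

text \<open>Automatic continuity: \<open>character\<close> asks only for algebraic properties, and
  the bound comes from the spectrum.\<close>

lemma character_bound: "character \<phi> \<Longrightarrow> cmod (\<phi> x) \<le> norm x"
  by (intro cmod_le_norm_of_spectrum character_in_spectrum)

lemma character_right_identity:
  assumes "character \<phi>" "\<And>x. x * e = x"
  shows "\<phi> e = 1"
proof -
  obtain x where x: "\<phi> x \<noteq> 0" using assms(1) by (auto simp: character_def)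
  have "\<phi> x * \<phi> e = \<phi> x" using assms by (metis character_mult)
  then show ?thesis using x by simp
qed

lemma bounded_linear_character:
  assumes "character \<phi>"
  shows "bounded_linear \<phi>"
proof (rule bounded_linear_intro)
  show "\<phi> (r *\<^sub>R x) = r *\<^sub>R \<phi> x" for r x
    by (metis assms character_scaleC scaleC_of_real scaleR_conv_of_real)
  show "norm (\<phi> x) \<le> norm x * 1" for x using character_bound[OF assms] by simp
qed (simp add: character_add assms)

locale annihilator_radical_algebra =
  fixes e :: "'a::complex_banach_algebra"
  assumes radical_eq: "(jacobson_radical :: 'a set) = right_annihilator"
    and commutator_in_radical: "x * y - y * x \<in> (jacobson_radical :: 'a set)"
    and right_identity: "x * e = x"
begin

lemma character_e: "character \<phi> \<Longrightarrow> \<phi> e = 1"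
  using character_right_identity right_identity by blast

section \<open>Maximal modular left ideals, characters and the spectrum\<close>

lemma right_annihilator_iff: "x \<in> right_annihilator \<longleftrightarrow> e * x = 0"
proof
  assume "e * x = 0"
  then have "a * x = 0" for a by (metis mult.assoc mult_zero_right right_identity)
  then show "x \<in> right_annihilator" by (simp add: right_annihilator_def)
qed (simp add: right_annihilator_def)

lemma character_right_annihilator:
  assumes "character \<phi>" "(x :: 'a) \<in> right_annihilator"
  shows "\<phi> x = 0"
  using assms character_mult[of \<phi> e x] character_e[of \<phi>]
  by (simp add: right_annihilator_iff character_zero)

text \<open>\<open>L\<close> contains the radical, hence all commutators. Maximality makes every
  element outside \<open>L\<close> invertible modulo \<open>L\<close>, and Gelfand--Mazur identifies
  the quotient with the complex numbers.\<close>

lemma character_of_maximal_ideal: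
  assumes "maximal_modular_left_ideal (L :: 'a set)"
  shows "\<exists>\<phi>. character \<phi> \<and> (\<forall>x. \<phi> x = 0 \<longleftrightarrow> x \<in> L)"
proof -
  have li: "left_ideal L" and L_ne: "L \<noteq> UNIV"
    and maximal: "\<And>J. left_ideal J \<Longrightarrow> L \<subseteq> J \<Longrightarrow> J \<noteq> UNIV \<Longrightarrow> J = L"
    using assms by (auto simp: maximal_modular_left_ideal_def modular_left_ideal_def)
  have comm: "x * y - y * x \<in> L" for x y
    using commutator_in_radical[of x y] assms by (auto simp: jacobson_radical_def)
  have "e \<notin> L"
  proof
    assume "e \<in> L"
    then have "x * e \<in> L" for x using li by (simp add: left_ideal_def)
    then show False using L_ne by (auto simp: right_identity)
  qed
  then interpret Q: commutative_unital_quotient L e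
    using li comm right_identity by unfold_locales
  have "\<exists>z. Q.eqv (x * z) e" if x: "x \<notin> L" for x
  proof -
    \<comment> \<open>The left ideal generated by \<open>L\<close> and \<open>x\<close>. It contains
      \<open>x\<close> because \<open>x - e * x\<close> is a commutator, thus in
      \<open>L\<close>.\<close>
    define J where "J = {l + a * x |l a. l \<in> L}"
    have mem: "l + a * x \<in> J" if "l \<in> L" for l a using that by (auto simp: J_def)
    have "left_ideal J"
      unfolding left_ideal_def
    proof (intro conjI ballI allI)
      show "0 \<in> J" using mem[OF Q.L_zero, of 0] by simp
    next
      fix u v assume "u \<in> J" "v \<in> J"
      then obtain l a m b where *: "u = l + a * x" "l \<in> L" "v = m + b * x" "m \<in> L" by (auto simp: J_def)
      then have "u + v = (l + m) + (a + b) * x" by (simp add: algebra_simps)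
      then show "u + v \<in> J" using mem Q.L_add * by metis
    next
      fix c u assume "u \<in> J"
      then obtain l a where *: "u = l + a * x" "l \<in> L" by (auto simp: J_def)
      then have "scaleC c u = scaleC c l + scaleC c a * x" by (simp add: scaleC_add_right mult_scaleC_left)
      then show "scaleC c u \<in> J" using mem Q.L_scaleC * by metis
    next
      fix b u assume "u \<in> J"
      then obtain l a where *: "u = l + a * x" "l \<in> L" by (auto simp: J_def)
      then have "b * u = b * l + (b * a) * x" by (simp add: distrib_left mult.assoc)
      then show "b * u \<in> J" using mem Q.L_mult_left * by metis
    qed
    moreover have "L \<subseteq> J" using mem[of _ 0] by auto
    moreover have "x \<in> J"
      using mem[OF comm[of x e], of e] by (simp add: right_identity)
    ultimately have "J = UNIV" using maximal x by blast
    then have "e \<in> J" by simp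
    then obtain l a where "e = l + a * x" "l \<in> L" by (auto simp: J_def)
    then have "Q.eqv (a * x) e" using Q.L_minus[of l] by (simp add: Q.eqv_def)
    then show ?thesis using Q.eqv_trans[OF Q.eqv_commute] by blast
  qed
  then have "\<exists>c. x - scaleC c e \<in> L" for x by (rule Q.gelfand_mazur)
  then obtain \<phi> where \<phi>: "\<And>x. x - scaleC (\<phi> x) e \<in> L" by metis
  have unique: "\<phi> x = c" if "x - scaleC c e \<in> L" for x c
  proof (rule ccontr)
    assume ne: "\<phi> x \<noteq> c"
    have "scaleC (\<phi> x - c) e \<in> L"
      using Q.L_diff[OF that \<phi>[of x]] by (simp add: scaleC_diff_left)
    then have "scaleC (1 / (\<phi> x - c)) (scaleC (\<phi> x - c) e) \<in> L" by (rule Q.L_scaleC)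
    then show False using ne \<open>e \<notin> L\<close> by (simp add: scaleC_scaleC scaleC_one)
  qed
  have "character \<phi>"
    unfolding character_def
  proof (intro conjI allI)
    show "\<phi> (x + y) = \<phi> x + \<phi> y" for x y
      using Q.L_add[OF \<phi>[of x] \<phi>[of y]] by (intro unique) (simp add: scaleC_add_left algebra_simps)
    show "\<phi> (scaleC c x) = c * \<phi> x" for c x
      using Q.L_scaleC[OF \<phi>[of x], of c] by (intro unique) (simp add: scaleC_diff_right scaleC_scaleC)
    show "\<phi> (x * y) = \<phi> x * \<phi> y" for x y
    proof (rule unique)
      have "x * (y - scaleC (\<phi> y) e) + scaleC (\<phi> y) (x - scaleC (\<phi> x) e) \<in> L"
        by (intro Q.L_add Q.L_mult_left Q.L_scaleC \<phi>)
      then show "x * y - scaleC (\<phi> x * \<phi> y) e \<in> L"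
        by (simp add: right_diff_distrib mult_scaleC_right right_identity scaleC_diff_right scaleC_scaleC mult.commute)
    qed
    have "\<phi> e = 1" by (rule unique) (simp add: scaleC_one Q.L_zero)
    then show "\<exists>x. \<phi> x \<noteq> 0" by (intro exI[of _ e]) simp
  qed
  moreover have "\<phi> x = 0 \<longleftrightarrow> x \<in> L" for x
    using \<phi>[of x] unique[of x 0] by auto
  ultimately show ?thesis by blast
qed

lemma right_annihilator_if_characters_zero:
  assumes "\<And>\<phi>. character \<phi> \<Longrightarrow> \<phi> x = 0"
  shows "x \<in> (right_annihilator :: 'a set)"
  unfolding radical_eq[symmetric] jacobson_radical_def
  using character_of_maximal_ideal assms by blast

text \<open>The left ideal of all \<open>y - y * b\<close> misses \<open>b\<close>. Zorn enlarges it
  to a left ideal maximal among those missing \<open>b\<close>, which is a maximal modular left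
  ideal; its character sends \<open>b\<close> to 1.\<close>

lemma character_if_not_quasi_invertible:
  assumes "\<not> quasi_invertible (b :: 'a)"
  shows "\<exists>\<phi>. character \<phi> \<and> \<phi> b = 1"
proof -
  define I where "I = {y - y * b |y. True}"
  have I: "y - y * b \<in> I" for y by (auto simp: I_def)
  have li: "left_ideal I"
    unfolding left_ideal_def
  proof (intro conjI ballI allI)
    show "0 \<in> I" using I[of 0] by simp
  next
    fix u v assume "u \<in> I" "v \<in> I"
    then obtain x y where uv: "u = x - x * b" "v = y - y * b" by (auto simp: I_def)
    have "u + v = (x + y) - (x + y) * b" unfolding uv by (simp add: algebra_simps)
    then show "u + v \<in> I" using I by metis
  next
    fix c u assume "u \<in> I"
    then obtain x where "u = x - x * b" by (auto simp: I_def)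
    then show "scaleC c u \<in> I" using I[of "scaleC c x"] by (simp add: scaleC_diff_right mult_scaleC_left)
  next
    fix a u assume "u \<in> I"
    then obtain x where "u = x - x * b" by (auto simp: I_def)
    then show "a * u \<in> I" using I[of "a * x"] by (simp add: right_diff_distrib mult.assoc)
  qed
  have b_notin: "b \<notin> I"
  proof
    assume "b \<in> I"
    then obtain x where x: "b = x - x * b" by (auto simp: I_def)
    define y where "y = - x"
    have yb: "y * b = b + y" using x by (simp add: y_def algebra_simps)
    \<comment> \<open>\<open>y\<close> is a left quasi-inverse of \<open>b\<close>. The commutator
      \<open>r\<close> lies in the right annihilator, so \<open>y * r = 0\<close>, while
      \<open>y * b = b + y\<close> gives \<open>y * r = r\<close>. Hence \<open>r = 0\<close> and
      \<open>y\<close> is also a right quasi-inverse.\<close>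
    define r where "r = y * b - b * y"
    have "r \<in> right_annihilator" using commutator_in_radical[of y b] by (simp add: r_def radical_eq)
    then have "y * r = 0" by (simp add: right_annihilator_def)
    moreover have "y * r = y * (y * b) - (y * b) * y" by (simp add: r_def right_diff_distrib mult.assoc)
    then have "y * r = r" by (simp add: yb r_def algebra_simps)
    ultimately have "b * y = b + y" using yb by (simp add: r_def)
    then have "b + y - b * y = 0" "y + b - y * b = 0" using yb by (simp_all add: add.commute)
    then show False using assms by (auto simp: quasi_invertible_def)
  qed
  define \<A> where "\<A> = {J. left_ideal J \<and> I \<subseteq> J \<and> b \<notin> J}"
  have "\<exists>M\<in>\<A>. \<forall>X\<in>\<A>. M \<subseteq> X \<longrightarrow> X = M"
  proof (rule subset_Zorn_nonempty)
    show "\<A> \<noteq> {}" using li b_notin by (auto simp: \<A>_def)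
    fix \<C> assume ne: "\<C> \<noteq> {}" and chain: "subset.chain \<A> \<C>"
    have sub: "\<And>J. J \<in> \<C> \<Longrightarrow> left_ideal J \<and> I \<subseteq> J \<and> b \<notin> J"
      using chain by (auto simp: subset.chain_def \<A>_def)
    have "left_ideal (\<Union>\<C>)"
      unfolding left_ideal_def
    proof (intro conjI ballI allI)
      show "0 \<in> \<Union>\<C>" using ne sub by (auto simp: left_ideal_def)
    next
      fix u v assume "u \<in> \<Union>\<C>" "v \<in> \<Union>\<C>"
      then obtain J K where JK: "J \<in> \<C>" "K \<in> \<C>" "u \<in> J" "v \<in> K" by auto
      then have "J \<subseteq> K \<or> K \<subseteq> J" using chain by (auto simp: subset_chain_def)
      then obtain H where H: "H \<in> \<C>" "u \<in> H" "v \<in> H" using JK by blast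
      then have "u + v \<in> H" using sub[OF H(1)] by (simp add: left_ideal_def)
      then show "u + v \<in> \<Union>\<C>" using H by blast
    qed (use sub in \<open>unfold left_ideal_def, blast\<close>)+
    then show "\<Union>\<C> \<in> \<A>" using ne sub by (auto simp: \<A>_def)
  qed
  then obtain M where M: "left_ideal M" "I \<subseteq> M" "b \<notin> M"
    and max: "\<And>X. X \<in> \<A> \<Longrightarrow> M \<subseteq> X \<Longrightarrow> X = M" by (auto simp: \<A>_def)
  have mod: "x - x * b \<in> M" for x using M I by blast
  have "maximal_modular_left_ideal M"
    unfolding maximal_modular_left_ideal_def modular_left_ideal_def
  proof (intro conjI allI impI)
    fix J assume J: "left_ideal J \<and> M \<subseteq> J \<and> J \<noteq> UNIV"
    \<comment> \<open>\<open>b\<close> is a modular unit: a left ideal containing \<open>M\<close>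
      and \<open>b\<close> contains every \<open>x = (x - x * b) + x * b\<close>.\<close>
    have "b \<notin> J"
    proof
      assume "b \<in> J"
      then have "(x - x * b) + x * b \<in> J" for x using J mod unfolding left_ideal_def by blast
      then show False using J by auto
    qed
    then show "J = M" using J M by (intro max) (auto simp: \<A>_def)
  qed (use M mod in auto)
  then obtain \<phi> where \<phi>: "character \<phi>" "\<And>x. \<phi> x = 0 \<longleftrightarrow> x \<in> M"
    using character_of_maximal_ideal by blast
  have "\<phi> (e - e * b) = 0" using \<phi> mod by blast
  then have "\<phi> b = 1" using \<phi>(1) by (simp add: character_simps character_e)
  then show ?thesis using \<phi> by blast
qed

lemma character_of_spectrum:
  assumes "l \<in> spectrum (x :: 'a)" "l \<noteq> 0"
  shows "\<exists>\<phi>. character \<phi> \<and> \<phi> x = l"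
proof -
  obtain \<phi> where "character \<phi>" "\<phi> (scaleC (1 / l) x) = 1"
    using assms character_if_not_quasi_invertible by (auto simp: spectrum_def)
  then show ?thesis using assms by (auto simp: character_scaleC field_simps)
qed

end

section \<open>Derivations vanish modulo the radical\<close>

locale annihilator_radical_derivation = annihilator_radical_algebra e
  for e :: "'a::complex_banach_algebra" +
  fixes d :: "'a \<Rightarrow> 'a"
  assumes derivation: "is_derivation d"
begin

lemma d_add: "d (x + y) = d x + d y"
  and d_scaleC: "d (scaleC c x) = scaleC c (d x)"
  and d_mult: "d (x * y) = d x * y + x * d y"
  using derivation by (auto simp: is_derivation_def clinear_map_def)

lemma d_zero: "d 0 = 0"
  using d_scaleC[of 0 0] by simp

lemma d_minus: "d (- x) = - d x"
  using d_scaleC[of "-1" x] by (simp add: scaleC_minus_left scaleC_one)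

lemma d_diff: "d (x - y) = d x - d y"
  using d_add[of x "- y"] by (simp add: d_minus)

lemma character_d_mult:
  "character \<phi> \<Longrightarrow> \<phi> (d (x * y)) = \<phi> (d x) * \<phi> y + \<phi> x * \<phi> (d y)"
  by (simp add: d_mult character_simps)

lemma d_right_annihilator:
  assumes "x \<in> right_annihilator"
  shows "d x \<in> right_annihilator"
proof -
  have "a * d x = d (a * x) - d a * x" for a by (simp add: d_mult)
  then show ?thesis using assms by (simp add: right_annihilator_def d_zero)
qed

section \<open>Characters whose composition with \<open>d\<close> is discontinuous\<close>

definition singular :: "('a \<Rightarrow> complex) \<Rightarrow> bool" where
  "singular \<phi> \<longleftrightarrow> character \<phi> \<and> \<not> (\<exists>K. \<forall>x. cmod (\<phi> (d x)) \<le> K * norm x)"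

lemma singular_large_value:
  assumes "singular \<phi>" "\<epsilon> > 0"
  shows "\<exists>x. norm x \<le> \<epsilon> \<and> T < cmod (\<phi> (d x))"
proof -
  have \<phi>: "character \<phi>" using assms by (simp add: singular_def)
  obtain x where x: "\<bar>T\<bar> / \<epsilon> * norm x < cmod (\<phi> (d x))"
    using assms unfolding singular_def by (meson linorder_not_le)
  then have "x \<noteq> 0" using \<phi> by (auto simp: d_zero character_zero)
  define c where "c = complex_of_real (\<epsilon> / norm x)"
  have "norm (scaleC c x) = \<epsilon>" using \<open>x \<noteq> 0\<close> assms by (simp add: norm_scaleC c_def norm_divide)
  moreover have "cmod (\<phi> (d (scaleC c x))) = \<epsilon> / norm x * cmod (\<phi> (d x))"
    using \<phi> assms by (simp add: d_scaleC character_scaleC norm_mult c_def norm_divide)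
  moreover have "T < \<epsilon> / norm x * cmod (\<phi> (d x))"
  proof -
    have "\<bar>T\<bar> = \<epsilon> / norm x * (\<bar>T\<bar> / \<epsilon> * norm x)" using \<open>x \<noteq> 0\<close> assms by simp
    also have "\<dots> < \<epsilon> / norm x * cmod (\<phi> (d x))"
      using x \<open>x \<noteq> 0\<close> assms by (intro mult_strict_left_mono) auto
    finally show ?thesis by simp
  qed
  ultimately show ?thesis by (metis order_refl)
qed

text \<open>Take \<open>x\<close> with values 0 and 1 at two characters of \<open>\<Phi>\<close>.
  Every character is nonzero at \<open>x\<close> or at \<open>e - x\<close>, so one of these two
  elements is nonzero at infinitely many, and each of them is killed by one of the two
  chosen.\<close>

lemma splitting_element:
  assumes "infinite \<Phi>" "\<And>\<phi>. \<phi> \<in> \<Phi> \<Longrightarrow> character \<phi>"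
  shows "\<exists>\<phi>\<in>\<Phi>. \<exists>b::'a. norm b \<le> 1 \<and> \<phi> b = 0 \<and> infinite {\<psi>\<in>\<Phi>. \<psi> b \<noteq> 0}"
proof -
  obtain \<psi>1 where 1: "\<psi>1 \<in> \<Phi>" using assms(1) by (metis finite.emptyI ex_in_conv)
  obtain \<psi>2 where 2: "\<psi>2 \<in> \<Phi>" "\<psi>2 \<noteq> \<psi>1"
    using assms(1) by (metis finite.simps finite_insert finite_subset singletonI subsetI insertI1)
  obtain y where y: "\<psi>1 y \<noteq> \<psi>2 y" using 2 by (metis ext)
  have c1: "character \<psi>1" and c2: "character \<psi>2" using 1 2 assms by auto
  define x where "x = scaleC (1 / (\<psi>2 y - \<psi>1 y)) (y - scaleC (\<psi>1 y) e)"
  have x1: "\<psi>1 x = 0" using c1 by (simp add: x_def character_simps character_e)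
  have x2: "\<psi>2 x = 1" using c2 y by (simp add: x_def character_simps character_e)
  have "\<exists>\<phi>\<in>\<Phi>. \<exists>b::'a. \<phi> b = 0 \<and> infinite {\<psi>\<in>\<Phi>. \<psi> b \<noteq> 0}"
  proof (cases "infinite {\<psi>\<in>\<Phi>. \<psi> x \<noteq> 0}")
    case True
    then show ?thesis using 1 x1 by blast
  next
    case False
    then have "infinite (\<Phi> - {\<psi>\<in>\<Phi>. \<psi> x \<noteq> 0})" using assms(1) by (simp add: Diff_infinite_finite)
    moreover have "\<Phi> - {\<psi>\<in>\<Phi>. \<psi> x \<noteq> 0} \<subseteq> {\<psi>\<in>\<Phi>. \<psi> (e - x) \<noteq> 0}"
      using assms(2) by (auto simp: character_diff character_e)
    ultimately have "infinite {\<psi>\<in>\<Phi>. \<psi> (e - x) \<noteq> 0}" using finite_subset by blast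
    moreover have "\<psi>2 (e - x) = 0" using c2 x2 by (simp add: character_diff character_e)
    ultimately show ?thesis using 2 by blast
  qed
  then obtain \<phi> b where b: "\<phi> \<in> \<Phi>" "\<phi> b = 0" "infinite {\<psi>\<in>\<Phi>. \<psi> b \<noteq> 0}" by blast
  define t where "t = complex_of_real (1 / (1 + norm b))"
  have pos: "1 + norm b > 0" by (simp add: add_pos_nonneg)
  then have t: "t \<noteq> 0" unfolding t_def of_real_eq_0_iff by simp
  have norm_t: "norm (scaleC t b) \<le> 1" using pos by (simp add: norm_scaleC t_def norm_divide field_simps del: of_real_add of_real_divide)
  have "\<psi> (scaleC t b) = 0 \<longleftrightarrow> \<psi> b = 0" if "\<psi> \<in> \<Phi>" for \<psi>
    using assms(2)[OF that] t by (simp add: character_scaleC)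
  then have "{\<psi>\<in>\<Phi>. \<psi> (scaleC t b) \<noteq> 0} = {\<psi>\<in>\<Phi>. \<psi> b \<noteq> 0}" "\<phi> (scaleC t b) = 0" using b by auto
  then show ?thesis using b(1,3) norm_t by (intro bexI[of _ \<phi>] exI[of _ "scaleC t b"]) simp_all
qed

text \<open>Gliding hump: with \<open>c n\<close> the product of the first \<open>n\<close> splitting elements, the partial sums of
  a suitable series of multiples of the \<open>c n\<close> make \<open>\<phi> n (d X)\<close> large, while \<open>\<phi> n\<close> kills
  \<open>c (n + 1)\<close>, a left factor of the tail, so that the tail contributes boundedly.\<close>

lemma finite_singular: "finite {\<phi>. singular \<phi>}"
proof (rule ccontr)
  assume inf: "infinite {\<phi>. singular \<phi>}"
  let ?P = "\<lambda>n::nat. \<lambda>\<Psi>. infinite \<Psi> \<and> \<Psi> \<subseteq> {\<phi>. singular \<phi>}"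
  let ?Q = "\<lambda>n::nat. \<lambda>\<Psi> \<Psi>'. \<exists>\<phi>\<in>\<Psi>. \<exists>b::'a. norm b \<le> 1 \<and> \<phi> b = 0 \<and> \<Psi>' = {\<psi>\<in>\<Psi>. \<psi> b \<noteq> 0}"
  \<comment> \<open>\<open>S\<close> is a decreasing sequence of infinite sets:
    \<open>S (Suc n)\<close> retains the characters nonzero at the splitting element
    \<open>b n\<close>. Hence \<open>\<phi> m (b n) \<noteq> 0\<close> whenever
    \<open>n < m\<close>.\<close>
  have "\<exists>S. \<forall>n. ?P n (S n) \<and> ?Q n (S n) (S (Suc n))"
  proof (rule dependent_nat_choice)
    show "\<exists>\<Psi>. ?P 0 \<Psi>" using inf by blast
    fix \<Psi> n assume \<Psi>: "?P n \<Psi>"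
    then have "\<exists>\<phi>\<in>\<Psi>. \<exists>b::'a. norm b \<le> 1 \<and> \<phi> b = 0 \<and> infinite {\<psi>\<in>\<Psi>. \<psi> b \<noteq> 0}"
      by (intro splitting_element) (auto simp: singular_def)
    then show "\<exists>\<Psi>'. ?P (Suc n) \<Psi>' \<and> ?Q n \<Psi> \<Psi>'" using \<Psi> by blast
  qed
  then obtain S where S_sing: "\<And>n. S n \<subseteq> {\<phi>. singular \<phi>}" and S: "\<And>n. ?Q n (S n) (S (Suc n))" by blast
  let ?R = "\<lambda>n p. fst p \<in> S n \<and> norm (snd p) \<le> 1 \<and> fst p (snd p) = 0 \<and> S (Suc n) = {\<psi>\<in>S n. \<psi> (snd p) \<noteq> 0}"
  have "\<forall>n. \<exists>p. ?R n p"
  proof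
    fix n
    obtain \<phi> b where "\<phi> \<in> S n" "norm b \<le> 1" "\<phi> b = 0" "S (Suc n) = {\<psi>\<in>S n. \<psi> b \<noteq> 0}"
      using S[of n] by blast
    then show "\<exists>p. ?R n p" by (intro exI[of _ "(\<phi>, b)"]) simp
  qed
  from choice[OF this] obtain p where p: "\<And>n. ?R n (p n)" by blast
  define \<phi> b where "\<phi> n = fst (p n)" and "b n = snd (p n)" for n
  have \<phi>_S: "\<phi> n \<in> S n" and b_norm: "norm (b n) \<le> 1" and \<phi>_b: "\<phi> n (b n) = 0"
    and S_Suc: "S (Suc n) = {\<psi>\<in>S n. \<psi> (b n) \<noteq> 0}" for n
    using p[of n] by (simp_all add: \<phi>_def b_def)
  have sing: "singular (\<phi> n)" for n using \<phi>_S S_sing by blast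
  then have char: "character (\<phi> n)" for n by (simp add: singular_def)
  have "antimono S" by (rule decseq_SucI) (auto simp: S_Suc)
  then have b_ne: "\<phi> m (b n) \<noteq> 0" if "n < m" for m n
    using \<phi>_S[of m] antimonoD[of S "Suc n" m] S_Suc[of n] that by auto
  \<comment> \<open>The product of \<open>b n\<close> up to \<open>b (n + k - 1)\<close>, so that
    \<open>c n\<close> can be split off on the left of every later term.\<close>
  define Q where "Q n k = rec_nat e (\<lambda>j q. q * b (n + j)) k" for n k
  have Q_0: "Q n 0 = e" and Q_Suc: "Q n (Suc k) = Q n k * b (n + k)" for n k by (simp_all add: Q_def)
  have Q_norm: "norm (Q n k) \<le> norm e" for n k
  proof (induction k)
    case (Suc k)
    have "norm (Q n (Suc k)) \<le> norm (Q n k) * norm (b (n + k))" by (simp add: Q_Suc norm_mult_ineq)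
    also have "\<dots> \<le> norm (Q n k)" using b_norm[of "n + k"] by (simp add: mult_left_le)
    finally show ?case using Suc by simp
  qed (simp add: Q_0)
  define c where "c = Q 0"
  have c_Suc: "c (Suc n) = c n * b n" for n by (simp add: c_def Q_Suc)
  have c_add: "c (n + k) = c n * Q n k" for n k
    by (induction k) (simp_all add: Q_0 Q_Suc right_identity c_Suc mult.assoc)
  have c_norm: "norm (c n) \<le> norm e" for n by (simp add: c_def Q_norm)
  have "\<phi> m (c n) \<noteq> 0" if "n \<le> m" for m n
    using that
  proof (induction n)
    case 0
    then show ?case using char by (simp add: c_def Q_0 character_e)
  next
    case (Suc n)
    then show ?case using b_ne[of n m] char by (simp add: c_Suc character_mult)
  qed
  then have \<phi>_c: "\<phi> n (c n) \<noteq> 0" for n by simp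
  have \<phi>_c_Suc: "\<phi> n (c (Suc n)) = 0" for n using char by (simp add: c_Suc character_mult \<phi>_b)
  \<comment> \<open>Bounds the contribution of the tail after term \<open>n\<close>;
    \<open>2 * norm e\<close> will bound the cofactor \<open>Y (Suc n)\<close>.\<close>
  define B where "B n = cmod (\<phi> n (d (c (Suc n)))) * (2 * norm e)" for n
  \<comment> \<open>Since \<open>\<phi> n\<close> is singular and
    \<open>\<phi> n (c n) \<noteq> 0\<close>, a small \<open>x\<close> can make
    \<open>\<phi> n (c n) * \<phi> n (d x)\<close> outweigh all other terms, whatever the partial
    sum \<open>s\<close> so far.\<close>
  have "\<exists>x. norm x \<le> (1/2)^n \<and> real n + B n \<le> cmod (\<phi> n (d (s + c n * x)))" for n s
  proof -
    define T where "T = real n + B n + cmod (\<phi> n (d s)) + cmod (\<phi> n (d (c n)))"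
    obtain x where x: "norm x \<le> (1/2)^n" "T / cmod (\<phi> n (c n)) < cmod (\<phi> n (d x))"
      using singular_large_value[OF sing, of "(1/2)^n"] by force
    have T: "T < cmod (\<phi> n (c n) * \<phi> n (d x))"
      using x \<phi>_c[of n] by (simp add: norm_mult field_simps)
    have "norm x \<le> 1" using x power_le_one[of "1/2::real" n] by simp
    then have "cmod (\<phi> n x) \<le> 1" using character_bound[OF char, of n x] by simp
    then have "cmod (\<phi> n (d (c n)) * \<phi> n x) \<le> cmod (\<phi> n (d (c n)))"
      by (simp add: norm_mult mult_left_le)
    moreover have "\<phi> n (d (s + c n * x)) = \<phi> n (c n) * \<phi> n (d x) - (- \<phi> n (d s) - \<phi> n (d (c n)) * \<phi> n x)"
      using char by (simp add: d_add character_add character_d_mult)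
    then have "cmod (\<phi> n (d (s + c n * x))) \<ge> cmod (\<phi> n (c n) * \<phi> n (d x)) - cmod (- \<phi> n (d s) - \<phi> n (d (c n)) * \<phi> n x)"
      using norm_triangle_ineq2 by metis
    moreover have "cmod (- \<phi> n (d s) - \<phi> n (d (c n)) * \<phi> n x) \<le> cmod (\<phi> n (d s)) + cmod (\<phi> n (d (c n)) * \<phi> n x)"
      using norm_triangle_ineq4[of "- \<phi> n (d s)"] by simp
    ultimately show ?thesis using x T by (intro exI[of _ x]) (simp add: T_def)
  qed
  then obtain f where f_norm: "\<And>n s. norm (f n s) \<le> (1/2)^n"
    and f_large: "\<And>n s. real n + B n \<le> cmod (\<phi> n (d (s + c n * f n s)))" by metis
  define s where "s n = rec_nat 0 (\<lambda>k s. s + c k * f k s) n" for n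
  define x where "x n = f n (s n)" for n
  have s_Suc: "s (Suc n) = s n + c n * x n" for n by (simp add: s_def x_def)
  have s_sum: "s n = (\<Sum>k<n. c k * x k)" for n
    by (induction n) (simp_all add: s_Suc, simp add: s_def)
  have x_norm: "norm (x n) \<le> (1/2)^n" for n by (simp add: x_def f_norm)
  have large: "real n + B n \<le> cmod (\<phi> n (d (s (Suc n))))" for n
    by (simp add: s_Suc x_def f_large)
  have Qx_norm: "norm (Q n k * x (n + k)) \<le> norm e * (1/2)^k" for n k
  proof -
    have "norm (Q n k * x (n + k)) \<le> norm (Q n k) * norm (x (n + k))" by (rule norm_mult_ineq)
    also have "\<dots> \<le> norm e * (1/2)^(n + k)" by (intro mult_mono Q_norm x_norm) auto
    also have "\<dots> \<le> norm e * (1/2)^k" by (intro mult_left_mono power_decreasing) auto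
    finally show ?thesis .
  qed
  have geo: "(\<lambda>k. norm e * (1/2)^k) sums (norm e * 2)"
    using sums_mult[OF geometric_sums[of "1/2::real"], of "norm e"] by simp
  have summ: "summable (\<lambda>k. Q n k * x (n + k))" for n
    by (rule summable_comparison_test'[OF sums_summable[OF geo], of 0]) (use Qx_norm in auto)
  define Y where "Y n = (\<Sum>k. Q n k * x (n + k))" for n
  have Y_norm: "norm (Y n) \<le> 2 * norm e" for n
  proof -
    have "norm (Y n) \<le> (\<Sum>k. norm e * (1/2)^k)"
      unfolding Y_def by (rule norm_suminf_le[OF Qx_norm sums_summable[OF geo]])
    then show ?thesis using geo by (simp add: sums_iff)
  qed
  define X where "X = (\<Sum>k. c k * x k)"
  have "summable (\<lambda>k. c k * x k)" using summ[of 0] by (simp add: c_def)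
  then have X: "X = s n + c n * Y n" for n
    unfolding X_def using suminf_split_initial_segment[of "\<lambda>k. c k * x k" n] suminf_mult[OF summ[of n], of "c n"]
    by (simp add: s_sum Y_def add.commute[of _ n] c_add mult.assoc)
  have "real n \<le> norm (d X)" for n
  proof -
    \<comment> \<open>As \<open>\<phi> n\<close> kills \<open>c (Suc n)\<close>, the Leibniz term
      containing the uncontrolled \<open>d (Y (Suc n))\<close> disappears.\<close>
    have "cmod (\<phi> n (d (c (Suc n) * Y (Suc n)))) = cmod (\<phi> n (d (c (Suc n)))) * cmod (\<phi> n (Y (Suc n)))"
      using char by (simp add: character_d_mult \<phi>_c_Suc norm_mult)
    also have "\<dots> \<le> B n"
      unfolding B_def using character_bound[OF char, of n "Y (Suc n)"] Y_norm[of "Suc n"]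
      by (intro mult_left_mono) auto
    finally have tail: "cmod (\<phi> n (d (c (Suc n) * Y (Suc n)))) \<le> B n" .
    have "\<phi> n (d X) = \<phi> n (d (s (Suc n))) + \<phi> n (d (c (Suc n) * Y (Suc n)))"
      using char X[of "Suc n"] by (simp add: d_add character_add)
    then have "cmod (\<phi> n (d (s (Suc n)))) \<le> cmod (\<phi> n (d X)) + cmod (\<phi> n (d (c (Suc n) * Y (Suc n))))"
      using norm_triangle_ineq4[of "\<phi> n (d X)" "\<phi> n (d (c (Suc n) * Y (Suc n)))"] by simp
    then show ?thesis using tail large[of n] character_bound[OF char, of n "d X"] by linarith
  qed
  then show False using reals_Archimedean2[of "norm (d X)"] by (meson linorder_not_le)
qed

text \<open>Modulo the radical, \<open>u * a\<close> is \<open>\<psi> a\<close> times \<open>u\<close>; applying \<open>\<psi> \<circ> d\<close> gives the claim.\<close>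

lemma isolated_character_d:
  assumes \<psi>: "character \<psi>" "\<psi> u = 1" and others: "\<And>\<phi>. character \<phi> \<Longrightarrow> \<phi> \<noteq> \<psi> \<Longrightarrow> \<phi> u = 0"
  shows "\<psi> (d a) = 0"
proof -
  have "\<phi> (u * a - scaleC (\<psi> a) u) = 0" if "character \<phi>" for \<phi>
    using that \<psi> others[of \<phi>] by (cases "\<phi> = \<psi>") (auto simp: character_simps)
  then have "d (u * a - scaleC (\<psi> a) u) \<in> right_annihilator"
    by (intro d_right_annihilator right_annihilator_if_characters_zero)
  then have "\<psi> (d (u * a - scaleC (\<psi> a) u)) = 0" by (rule character_right_annihilator[OF \<psi>(1)])
  then show ?thesis using \<psi> by (simp add: d_diff d_scaleC character_diff character_scaleC character_d_mult)
qed

text \<open>A product of factors, one for each \<open>\<phi>\<close> in \<open>G\<close>, that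
  vanish at \<open>\<phi>\<close> but not at \<open>\<psi>\<close>.\<close>

lemma separate_from_finite:
  assumes "finite G" "character \<psi>" "\<And>\<phi>. \<phi> \<in> G \<Longrightarrow> character \<phi>" "\<psi> \<notin> G"
  shows "\<exists>f::'a. \<psi> f \<noteq> 0 \<and> (\<forall>\<phi>\<in>G. \<phi> f = 0)"
  using assms
proof (induction G rule: finite_induct)
  case empty
  then show ?case by (intro exI[of _ e]) (simp add: character_e)
next
  case (insert \<phi> G)
  then obtain f where f: "\<psi> f \<noteq> 0" "\<forall>\<phi>\<in>G. \<phi> f = 0" by auto
  obtain y where y: "\<psi> y \<noteq> \<phi> y" using insert.prems(3) by (metis ext insertI1)
  have \<phi>: "character \<phi>" using insert.prems by simp
  define g where "g = y - scaleC (\<phi> y) e"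
  have "\<psi> g \<noteq> 0" "\<phi> g = 0" using y \<phi> insert.prems(1) by (simp_all add: g_def character_simps character_e)
  then show ?case using f \<phi> insert.prems by (intro exI[of _ "f * g"]) (auto simp: character_mult)
qed

text \<open>If \<open>\<psi> w \<noteq> 0\<close>, multiply \<open>w\<close> by an element killed by
  all other singular characters. The product is supported at \<open>\<psi>\<close> alone, so
  \<open>\<psi> \<circ> d = 0\<close>. Then \<open>\<psi>\<close> is not singular, and the
  assumption gives \<open>\<psi> w = 0\<close>.\<close>

lemma right_annihilator_if_regular_characters_zero:
  assumes "\<And>\<phi>. character \<phi> \<Longrightarrow> \<not> singular \<phi> \<Longrightarrow> \<phi> w = 0"
  shows "w \<in> right_annihilator"
proof (rule right_annihilator_if_characters_zero, rule ccontr)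
  fix \<psi> assume \<psi>: "character \<psi>" and w: "\<psi> w \<noteq> 0"
  have "finite ({\<phi>. singular \<phi>} - {\<psi>})" using finite_singular by simp
  then have "\<exists>f. \<psi> f \<noteq> 0 \<and> (\<forall>\<phi>\<in>{\<phi>. singular \<phi>} - {\<psi>}. \<phi> f = 0)"
    by (rule separate_from_finite) (simp_all add: \<psi> singular_def)
  then obtain f where f: "\<psi> f \<noteq> 0" "\<And>\<phi>. singular \<phi> \<Longrightarrow> \<phi> \<noteq> \<psi> \<Longrightarrow> \<phi> f = 0"
    by blast
  define u where "u = scaleC (1 / (\<psi> w * \<psi> f)) (w * f)"
  have "\<psi> u = 1" using \<psi> w f by (simp add: u_def character_scaleC character_mult)
  moreover have "\<phi> u = 0" if "character \<phi>" "\<phi> \<noteq> \<psi>" for \<phi>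
    using that assms f by (cases "singular \<phi>") (auto simp: u_def character_scaleC character_mult)
  ultimately have "\<psi> (d a) = 0" for a using isolated_character_d[OF \<psi>] by blast
  then have "\<not> singular \<psi>" by (auto simp: singular_def intro!: exI[of _ 0])
  then show False using assms \<psi> w by blast
qed

text \<open>Characters determine a limit only modulo the right annihilator. The factor
  \<open>e\<close> removes this ambiguity: a limit \<open>w\<close> of values
  \<open>e * d (X n)\<close> satisfies \<open>e * w = w\<close>, while regular characters give
  \<open>e * w = 0\<close>.\<close>

lemma e_d_bounded: "\<exists>C\<ge>0. \<forall>x. norm (e * d x) \<le> C * norm x"
proof (rule closed_graph_bounded)
  show "linear (\<lambda>x. e * d x)"
    by (rule linearI) (simp_all add: d_add distrib_left d_scaleC mult_scaleC_right flip: scaleC_of_real)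
next
  fix X w assume X: "X \<longlonglongrightarrow> 0" and w: "(\<lambda>n. e * d (X n)) \<longlonglongrightarrow> w"
  have "\<phi> w = 0" if \<phi>: "character \<phi>" "\<not> singular \<phi>" for \<phi>
  proof -
    obtain K where K: "\<And>x. cmod (\<phi> (d x)) \<le> K * norm x" using \<phi> by (auto simp: singular_def)
    have "(\<lambda>n. \<phi> (e * d (X n))) \<longlonglongrightarrow> \<phi> w"
      by (rule bounded_linear.tendsto[OF bounded_linear_character[OF \<phi>(1)] w])
    moreover have "(\<lambda>n. \<phi> (e * d (X n))) \<longlonglongrightarrow> 0"
    proof (rule Lim_null_comparison)
      show "\<forall>\<^sub>F n in sequentially. norm (\<phi> (e * d (X n))) \<le> K * norm (X n)"
        using K \<phi> by (simp add: character_mult character_e)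
      show "(\<lambda>n. K * norm (X n)) \<longlonglongrightarrow> 0"
        using tendsto_mult_right_zero[OF tendsto_norm_zero[OF X]] by simp
    qed
    ultimately show ?thesis by (rule LIMSEQ_unique)
  qed
  then have "e * w = 0"
    using right_annihilator_if_regular_characters_zero right_annihilator_iff by blast
  moreover have "(\<lambda>n. e * (e * d (X n))) \<longlonglongrightarrow> e * w" by (intro tendsto_intros w)
  then have "(\<lambda>n. e * d (X n)) \<longlonglongrightarrow> e * w" by (simp add: right_identity flip: mult.assoc)
  then have "e * w = w" using w LIMSEQ_unique by blast
  ultimately show "w = 0" by simp
qed

section \<open>Iterates of the derivation\<close>

lemma e_d_e: "e * d e = 0"
  using d_mult[of e e] by (simp add: right_identity)

text \<open>Since \<open>e * d e = 0\<close>, \<open>e * d z = e * d (e * z)\<close>; thus the bound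
  for one application of \<open>d\<close> can be iterated.\<close>

lemma e_d_funpow_bounded: "\<exists>C\<ge>0. \<forall>n x. norm (e * (d ^^ n) x) \<le> C ^ n * (norm e * norm x)"
proof -
  obtain C where C: "C \<ge> 0" "\<And>x. norm (e * d x) \<le> C * norm x" using e_d_bounded by blast
  have "norm (e * (d ^^ n) x) \<le> C ^ n * (norm e * norm x)" for n x
  proof (induction n)
    case 0 then show ?case by (simp add: norm_mult_ineq)
  next
    case (Suc n)
    have "e * d z = e * d (e * z)" for z
      by (simp add: d_mult distrib_left e_d_e right_identity flip: mult.assoc)
    then have "norm (e * (d ^^ Suc n) x) \<le> C * norm (e * (d ^^ n) x)"
      using C(2)[of "e * (d ^^ n) x"] by (metis comp_apply funpow.simps(2))
    also have "\<dots> \<le> C * (C ^ n * (norm e * norm x))" by (intro mult_left_mono Suc C)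
    finally show ?case by (simp add: mult.assoc)
  qed
  then show ?thesis using C by blast
qed

lemma funpow_d_add: "(d ^^ n) (x + y) = (d ^^ n) x + (d ^^ n) y"
  by (induction n) (simp_all add: d_add)

text \<open>In the Leibniz expansion every term with fewer than \<open>n\<close> derivatives on
  \<open>x\<close> vanishes under \<open>\<phi>\<close>.\<close>

lemma character_funpow_d_mult:
  assumes "character \<phi>" "\<And>m. m < n \<Longrightarrow> \<phi> ((d ^^ m) x) = 0"
  shows "\<phi> ((d ^^ n) (b * x)) = \<phi> b * \<phi> ((d ^^ n) x)"
  using assms(2)
proof (induction n arbitrary: b x)
  case 0 then show ?case using assms(1) by (simp add: character_mult)
next
  case (Suc n)
  have dx: "\<phi> ((d ^^ m) (d x)) = 0" if "m < n" for m
    using Suc.prems[of "Suc m"] that by (simp add: funpow_swap1)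
  have "\<phi> ((d ^^ Suc n) (b * x)) = \<phi> ((d ^^ n) (d b * x)) + \<phi> ((d ^^ n) (b * d x))"
    using assms(1) by (simp add: funpow_swap1[of d n] d_mult funpow_d_add character_add)
  also have "\<dots> = \<phi> (d b) * \<phi> ((d ^^ n) x) + \<phi> b * \<phi> ((d ^^ n) (d x))"
    using Suc.IH[of x "d b"] Suc.IH[of "d x" b] Suc.prems dx by simp
  finally show ?case using Suc.prems[of n] by (simp add: funpow_swap1)
qed

text \<open>With one more derivative, the Leibniz term without a derivative on \<open>a\<close> dies
  because \<open>\<phi> a = 0\<close>, and those with exactly one occur \<open>Suc n\<close>
  times.\<close>

lemma character_funpow_d_kernel_mult:
  assumes "character \<phi>" "\<phi> a = 0" "\<And>m. m < n \<Longrightarrow> \<phi> ((d ^^ m) x) = 0"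
  shows "\<phi> ((d ^^ Suc n) (a * x)) = of_nat (Suc n) * \<phi> (d a) * \<phi> ((d ^^ n) x)"
  using assms(3)
proof (induction n arbitrary: x)
  case 0 then show ?case using assms by (simp add: character_d_mult)
next
  case (Suc n)
  have dx: "\<phi> ((d ^^ m) (d x)) = 0" if "m < n" for m
    using Suc.prems[of "Suc m"] that by (simp add: funpow_swap1)
  have "\<phi> ((d ^^ Suc (Suc n)) (a * x)) = \<phi> ((d ^^ Suc n) (d a * x)) + \<phi> ((d ^^ Suc n) (a * d x))"
    using assms(1) by (simp only: funpow_Suc_right[of "Suc n"] o_def d_mult funpow_d_add character_add)
  also have "\<phi> ((d ^^ Suc n) (d a * x)) = \<phi> (d a) * \<phi> ((d ^^ Suc n) x)"
    by (rule character_funpow_d_mult[OF assms(1) Suc.prems])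
  also have "\<phi> ((d ^^ Suc n) (a * d x)) = of_nat (Suc n) * \<phi> (d a) * \<phi> ((d ^^ Suc n) x)"
    using Suc.IH[OF dx] by (simp add: funpow_swap1)
  finally show ?case by (simp add: algebra_simps)
qed

lemma character_d_zero:
  assumes \<phi>: "character \<phi>"
  shows "\<phi> (d a) = 0"
proof (rule ccontr)
  assume ne: "\<phi> (d a) \<noteq> 0"
  \<comment> \<open>Moves \<open>a\<close> into the kernel of \<open>\<phi>\<close> without changing
    \<open>\<phi> (d a)\<close>, as \<open>\<phi> (d e) = 0\<close>.\<close>
  define h where "h = a - scaleC (\<phi> a) e"
  have h: "\<phi> h = 0" using \<phi> by (simp add: h_def character_simps character_e)
  have "\<phi> (d e) = 0" using \<phi> arg_cong[OF e_d_e, of \<phi>] by (simp add: character_simps character_e)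
  then have dh: "\<phi> (d h) = \<phi> (d a)" using \<phi> by (simp add: h_def d_diff d_scaleC character_diff character_scaleC)
  define p where "p n = ((*) h ^^ n) e" for n
  have p_Suc: "p (Suc n) = h * p n" for n by (simp add: p_def)
  have zero: "\<phi> ((d ^^ m) (p n)) = 0" if "m < n" for m n
    using that
  proof (induction n arbitrary: m)
    case (Suc n)
    then show ?case
      using character_funpow_d_mult[OF \<phi>, of m "p n" h] by (simp add: p_Suc h)
  qed simp
  have top: "\<phi> ((d ^^ n) (p n)) = fact n * \<phi> (d a) ^ n" for n
  proof (induction n)
    case 0 then show ?case using \<phi> by (simp add: p_def character_e)
  next
    case (Suc n)
    then show ?case
      using character_funpow_d_kernel_mult[OF \<phi> h, of n "p n"] zero by (simp add: p_Suc dh algebra_simps)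
  qed
  have p_norm: "norm (p n) \<le> norm h ^ n * norm e" for n
  proof (induction n)
    case 0 then show ?case by (simp add: p_def)
  next
    case (Suc n)
    have "norm (p (Suc n)) \<le> norm h * norm (p n)" by (simp add: p_Suc norm_mult_ineq)
    also have "\<dots> \<le> norm h * (norm h ^ n * norm e)" by (intro mult_left_mono Suc) simp
    finally show ?case by (simp add: mult.assoc)
  qed
  obtain C where C: "C \<ge> 0" "\<And>n x. norm (e * (d ^^ n) x) \<le> C ^ n * (norm e * norm x)"
    using e_d_funpow_bounded by blast
  define t where "t = cmod (\<phi> (d a))"
  have t: "t > 0" using ne by (simp add: t_def)
  define q where "q = C * norm h / t"
  \<comment> \<open>Compares the exact value \<open>fact n * \<phi> (d a) ^ n\<close> with the
    geometric bound on the iterates; the right side tends to 0.\<close>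
  have "1 \<le> (norm e)\<^sup>2 * (inverse (fact n) * q ^ n)" for n
  proof -
    have "fact n * t ^ n = cmod (\<phi> (e * (d ^^ n) (p n)))"
      using \<phi> by (simp add: character_mult character_e top norm_mult norm_power t_def)
    also have "\<dots> \<le> norm (e * (d ^^ n) (p n))" by (rule character_bound[OF \<phi>])
    also have "\<dots> \<le> C ^ n * (norm e * norm (p n))" by (rule C)
    also have "\<dots> \<le> C ^ n * (norm e * (norm h ^ n * norm e))"
      using C by (intro mult_left_mono p_norm) auto
    finally have "fact n * t ^ n \<le> (norm e)\<^sup>2 * (C * norm h) ^ n"
      by (simp add: power_mult_distrib power2_eq_square mult_ac)
    then show ?thesis using t by (simp add: q_def power_divide field_simps)
  qed
  moreover have "(\<lambda>n. (norm e)\<^sup>2 * (inverse (fact n) * q ^ n)) \<longlonglongrightarrow> 0"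
    by (intro tendsto_mult_right_zero summable_LIMSEQ_zero summable_exp)
  ultimately have "(1::real) \<le> 0" by (intro LIMSEQ_le_const) auto
  then show False by simp
qed

end

theorem theorem3p4:
  fixes \<delta> :: "'a::complex_banach_algebra \<Rightarrow> 'a"
  assumes "(jacobson_radical :: 'a set) = right_annihilator"
    and "\<forall>a b :: 'a. a * b - b * a \<in> jacobson_radical"
    and "\<exists>e :: 'a. \<forall>a. a * e = a"
    and "is_generalized_derivation \<delta>"
  shows "spectrally_bounded \<delta>"
proof -
  obtain e :: 'a where e: "\<And>a. a * e = a" using assms(3) by blast
  obtain d where d: "is_derivation d" and \<delta>: "\<And>a b. \<delta> (a * b) = a * \<delta> b + d a * b"
    and lin: "clinear_map \<delta>"
    using assms(4) by (auto simp: is_generalized_derivation_def)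
  interpret annihilator_radical_derivation e d
    using assms(1,2) e d by unfold_locales auto
  have \<delta>_eq: "\<delta> a = a * \<delta> e + d a" for a using \<delta>[of a e] by (simp add: e)
  have "spectral_radius (\<delta> a) \<le> norm (\<delta> e) * spectral_radius a" for a
  proof (rule spectral_radius_le)
    fix l assume l: "l \<in> spectrum (\<delta> a)"
    show "cmod l \<le> norm (\<delta> e) * spectral_radius a"
    \<comment> \<open>By definition 0 lies in every spectrum, so it need not be the value of a
      character.\<close>
    proof (cases "l = 0")
      case True then show ?thesis using spectral_radius_nonneg[of a] by simp
    next
      case False
      then obtain \<phi> where \<phi>: "character \<phi>" "\<phi> (\<delta> a) = l" using character_of_spectrum l by blast
      then have "l = \<phi> (\<delta> e) * \<phi> a"
        using \<delta>_eq[of a] character_d_zero[OF \<phi>(1), of a] by (simp add: character_simps mult.commute)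
      moreover have "cmod (\<phi> (\<delta> e)) * cmod (\<phi> a) \<le> norm (\<delta> e) * spectral_radius a"
        using \<phi> by (intro mult_mono character_bound cmod_le_spectral_radius character_in_spectrum) auto
      ultimately show ?thesis by (simp add: norm_mult)
    qed
  qed
  then show ?thesis using lin unfolding spectrally_bounded_def by (intro conjI exI[of _ "norm (\<delta> e)"]) auto
qed

end
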